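(* For every pair of positive integers $d_1, d_2$, \[ \operatorname{mv}(d_1+d_2) \ge \operatorname{mv}(d_1)\,\operatorname{mv}(d_2). \]
   Context: A lattice $\Lambda\subset\mathbb{R}^d$ is a discrete subgroup of rank $d$. A $d$-dimensional simplex $L=\operatorname{conv}\{v_0,\dots,v_d\}$ with $v_i\in\Lambda$ is a Delone simplex of $\Lambda$ if there exist a center $c\in\mathbb{R}^d$ and a radius $r>0$ with $\|v_i-c\|=r$ for $i=0,\dots,d$ and $\|v-c\|>r$ for all other $v\in\Lambda\setminus\{v_0,\dots,v_d\}$ (Euclidean norm). The relative volume of a lattice simplex $L$ with vertices in $\Lambda$ is $\operatorname{vol}(L)\cdot d!/\det(\Lambda)$, equivalently the index in $\Lambda$ of the lattice affinely generated by the vertices of $L$ (i.e. the volume of $L$ divided by the volume of a simplex whose vertices form an affine basis of $\Lambda$). $\operatorname{mv}(d)$ denotes the maximum relative volume of a $d$-dimensional Delone simplex, the maximum taken over all lattices $\Lambda\subset\mathbb{R}^d$ and all Delone simplices of $\Lambda$. *)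

theory Defs
  imports "HOL-Analysis.Analysis"
begin

text \<open>
  The space \<open>\<real>\<^sup>d\<close> is \<^typ>\<open>real ^ 'n\<close> with \<open>d = CARD('n)\<close>. For a discrete subgroup, the rank
  as an abelian group is the dimension of the linear span, which is what \<^const>\<open>dim\<close> measures.
\<close>

definition lattice_in :: "(real ^ 'n) set \<Rightarrow> bool" where
  "lattice_in \<Lambda> \<longleftrightarrow>
     0 \<in> \<Lambda> \<and> (\<forall>x\<in>\<Lambda>. \<forall>y\<in>\<Lambda>. x - y \<in> \<Lambda>) \<and> discrete \<Lambda> \<and> dim \<Lambda> = CARD('n)"

definition lattice_basis :: "(real ^ 'n) set \<Rightarrow> real ^ 'n ^ 'n \<Rightarrow> bool" where
  "lattice_basis \<Lambda> B \<longleftrightarrow> invertible B \<and> \<Lambda> = {B *v z | z. \<forall>i. z $ i \<in> \<int>}"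

text \<open>The value \<open>\<bar>det B\<bar>\<close> is the same for all bases \<open>B\<close> of a lattice, and every lattice has one.\<close>

definition lattice_det :: "(real ^ 'n) set \<Rightarrow> real" where
  "lattice_det \<Lambda> = (THE D. \<exists>B. lattice_basis \<Lambda> B \<and> D = \<bar>det B\<bar>)"

definition delone_simplex :: "(real ^ 'n) set \<Rightarrow> (real ^ 'n) set \<Rightarrow> bool" where
  "delone_simplex \<Lambda> L \<longleftrightarrow>
     (\<exists>V. V \<subseteq> \<Lambda> \<and> card V = CARD('n) + 1 \<and> \<not> affine_dependent V \<and> L = convex hull V \<and>
        (\<exists>c r. r > 0 \<and> (\<forall>v\<in>V. norm (v - c) = r) \<and> (\<forall>v\<in>\<Lambda> - V. norm (v - c) > r)))"

definition relative_volume :: "(real ^ 'n) set \<Rightarrow> (real ^ 'n) set \<Rightarrow> real" where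
  "relative_volume \<Lambda> L = measure lebesgue L * fact CARD('n) / lattice_det \<Lambda>"

text \<open>
  The number \<open>mv(d)\<close> for \<open>d = CARD('n)\<close>; the dimension is passed as a type argument. On the reals,
  \<open>GREATEST\<close> is the maximum whenever it is attained, and is unspecified otherwise. Here it is
  attained: relative volumes are positive integers, bounded in terms of \<open>d\<close>, and each dimension
  has a Delone simplex.
\<close>

definition mv :: "'n::finite itself \<Rightarrow> real" where
  "mv _ = (GREATEST m. \<exists>(\<Lambda> :: (real ^ 'n) set) L.
     lattice_in \<Lambda> \<and> delone_simplex \<Lambda> L \<and> m = relative_volume \<Lambda> L)"

end

theory Submission
  imports Defs
begin

text \<open>
  Let \<open>v\<^sub>i\<close> and \<open>w\<^sub>j\<close> be the nonzero vertices of optimal Delone simplices in dimensions \<open>d\<^sub>1\<close> and \<open>d\<^sub>2\<close>, each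
  translated to have a vertex at the origin. In the orthogonal sum of the two lattices the simplex with
  vertices \<open>0, (v\<^sub>i, 0), (0, w\<^sub>j)\<close> has the product of the relative volumes, but the points \<open>(v\<^sub>i, w\<^sub>j)\<close> also
  lie on its circumsphere. With linear functionals \<open>\<alpha>\<close> and \<open>\<beta>\<close> that are 1 on all \<open>v\<^sub>i\<close> and all \<open>w\<^sub>j\<close>,
  respectively, perturbing the quadratic form by \<open>2 \<epsilon> \<alpha>(x) \<beta>(y)\<close> pushes exactly these points outside, and
  for small \<open>\<epsilon> > 0\<close> all other lattice points stay outside. The perturbation is realized by a shear.

  That the maxima exist is part of the claim. The relative volume is an integer determinant \<open>\<bar>det K\<bar>\<close>. It is
  at most \<open>d ^ d\<close>: no nonzero lattice vector is a combination of the edge vectors at a vertex with absolute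
  coefficient sum below 1, so Blichfeldt's argument applies to a cube of side \<open>1 / d\<close>.
\<close>

section \<open>Volumes of simplices\<close>

text \<open>This and \<open>det_shear\<close> treat elementary matrices in the form in which
  \<open>induct_matrix_elementary_alt\<close> presents them; they also serve the volume formula for
  linear images.\<close>

lemma det_swap:
  assumes "m \<noteq> n"
  shows "det ((\<chi> i j. mat 1 $ i $ Transposition.transpose m n j) :: real^'n^'n) = - 1"
  using assms det_permute_columns[OF permutes_swap_id[of m UNIV n], of "mat 1 :: real^'n^'n"]
  by (simp add: sign_swap_id)

lemma det_shear:
  assumes "m \<noteq> n"
  shows "det ((\<chi> i j. of_bool (i = m \<and> j = n \<or> i = j)) :: real^'n^'n) = 1"
proof -
  have "((\<chi> i j. of_bool (i = m \<and> j = n \<or> i = j)) :: real^'n^'n)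
      = (\<chi> k. if k = m then row m (mat 1) + 1 *s row n (mat 1) else row k (mat 1))"
    using assms by (auto simp: vec_eq_iff row_def mat_def)
  then show ?thesis
    by (simp only: det_row_operation[OF assms] det_I)
qed

text \<open>The library proves this only for index types of class \<^class>\<open>wellorder\<close>.\<close>
lemma measurable_and_measure_linear_image:
  fixes f :: "real^'n \<Rightarrow> real^'n"
  assumes "linear f" "S \<in> lmeasurable"
  shows "f ` S \<in> lmeasurable \<and> measure lebesgue (f ` S) = \<bar>det (matrix f)\<bar> * measure lebesgue S"
proof -
  define P where "P f \<longleftrightarrow> (\<forall>S\<in>lmeasurable. f ` S \<in> lmeasurable \<and>
      measure lebesgue (f ` S) = \<bar>det (matrix f)\<bar> * measure lebesgue S)" for f :: "real^'n \<Rightarrow> real^'n"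
  \<comment> \<open>For swaps and shears, whose determinant has absolute value 1, boxes with a
    corner at the origin suffice: by linearity the image of any other box is a translate of such an
    image.\<close>
  have PI: "P f" if lin: "linear f" and box: "\<And>b. measure lebesgue (f ` cbox 0 b) = measure lebesgue (cbox 0 b)"
    and d: "\<bar>det (matrix f)\<bar> = 1" for f :: "real^'n \<Rightarrow> real^'n"
  proof -
    have "measure lebesgue (f ` cbox a b) = 1 * measure lebesgue (cbox a b)" for a b
    proof -
      have ab: "cbox a b = (+) a ` cbox 0 (b - a)"
        by (simp flip: cbox_translation)
      have "f ` cbox a b = (+) (f a) ` f ` cbox 0 (b - a)"
        unfolding ab image_comp by (intro image_cong) (auto simp: linear_add[OF lin])
      then show ?thesis
        unfolding ab by (simp only: measure_translation box mult_1)
    qed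
    note 1 = measure_linear_sufficient[OF lin _ this]
    show ?thesis
      unfolding P_def d using 1 by (intro ballI) (metis mult_1)
  qed
  have "P f"
  proof (rule induct_linear_elementary[OF assms(1)])
    show "P (f \<circ> g)" if "linear f" "linear g" "P f" "P g" for f g
      using that unfolding P_def image_comp[symmetric]
      by (simp add: matrix_compose det_mul abs_mult del: image_image)
  next
    fix f :: "real^'n \<Rightarrow> real^'n" and i
    assume f: "linear f" and 0: "\<And>x. f x $ i = 0"
    \<comment> \<open>A coordinate that is constantly zero makes \<open>f\<close> singular, so both
      sides of the volume formula are 0.\<close>
    have "axis i 1 \<notin> range f"
      using 0 by (metis axis_nth rangeE zero_neq_one)
    then have "\<not> inj f"
      using linear_injective_imp_surjective[OF f] by blast
    then show "P f"
      using f det_nz_iff_inj[OF f] negligible_linear_singular_image[OF f]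
      by (simp add: P_def negligible_iff_measure)
  next
    show "P (\<lambda>x. \<chi> i. c i * x $ i)" for c
      by (simp add: P_def measurable_stretch measure_stretch axis_def matrix_def det_diagonal)
  next
    fix m n :: 'n assume "m \<noteq> n"
    let ?t = "Transposition.transpose m n"
    let ?h = "\<lambda>x::real^'n. \<chi> i. x $ ?t i"
    show "P ?h"
    proof (rule PI)
      show "linear ?h"
        by (rule linearI) (simp_all add: vec_eq_iff)
      have "matrix ?h = transpose (\<chi> i j. mat 1 $ i $ ?t j)"
        by (auto simp: matrix_def mat_def axis_def transpose_def vec_eq_iff)
      then show "\<bar>det (matrix ?h)\<bar> = 1"
        by (simp add: det_transpose det_swap[OF \<open>m \<noteq> n\<close>])
      fix b :: "real^'n"
      have eq: "?h ` cbox 0 b = cbox 0 (?h b)"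
      proof (intro equalityI subsetI)
        fix x assume x: "x \<in> cbox 0 (?h b)"
        have "?h x \<in> cbox 0 b"
          using x by (auto simp: mem_box_cart) (metis transpose_involutory)
        moreover have "x = ?h (?h x)" by (simp add: vec_eq_iff)
        ultimately show "x \<in> ?h ` cbox 0 b" by blast
      qed (auto simp: mem_box_cart)
      have "(\<forall>i. 0 \<le> b $ ?t i) \<longleftrightarrow> (\<forall>i. 0 \<le> b $ i)"
        by (metis transpose_involutory)
      moreover have "(\<Prod>i\<in>UNIV. b $ ?t i) = (\<Prod>i\<in>UNIV. b $ i)"
        using prod.permute[OF permutes_swap_id, of m UNIV n "\<lambda>i. b $ i"] by (simp add: o_def)
      ultimately show "measure lebesgue (?h ` cbox 0 b) = measure lebesgue (cbox 0 b)"
        unfolding eq by (simp add: content_cbox_if_cart interval_eq_empty_cart not_less flip: not_le)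
    qed
  next
    fix m n :: 'n assume mn: "m \<noteq> n"
    let ?h = "\<lambda>x::real^'n. \<chi> i. if i = m then x $ m + x $ n else x $ i"
    show "P ?h"
    proof (rule PI)
      show "linear ?h"
        by (rule linearI) (auto simp: vec_eq_iff algebra_simps)
      have "matrix ?h = (\<chi> i j. of_bool (i = m \<and> j = n \<or> i = j))"
        using mn by (auto simp: matrix_def axis_def vec_eq_iff)
      then show "\<bar>det (matrix ?h)\<bar> = 1"
        by (simp only: det_shear[OF mn] abs_one)
      show "measure lebesgue (?h ` cbox 0 b) = measure lebesgue (cbox 0 b)" for b
        using measure_shear_interval[OF mn, of 0 b] by (cases "cbox 0 b = {}") simp_all
    qed
  qed
  then show ?thesis
    using assms(2) by (simp add: P_def)
qed

text \<open>The simplex is the image of the standard simplex, of volume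
  \<open>1 / fact CARD('n)\<close>, under \<open>x \<mapsto> v + A *v x\<close>.\<close>

lemma measure_simplex:
  fixes A :: "real^'n^'n"
  shows "measure lebesgue (convex hull (insert v ((\<lambda>i. v + column i A) ` UNIV))) = \<bar>det A\<bar> / fact CARD('n)"
proof -
  define std where "std = convex hull (insert 0 Basis :: (real^'n) set)"
  have "compact std"
    unfolding std_def by (intro finite_imp_compact_convex_hull) auto
  then have std: "std \<in> lmeasurable" "measure lebesgue std = 1 / fact CARD('n)"
    by (auto simp: std_def content_std_simplex lmeasurable_compact dest!: compact_imp_closed)
  have B: "(Basis :: (real^'n) set) = (\<lambda>i. axis i 1) ` UNIV"
    by (auto simp: Basis_vec_def)
  have "(\<lambda>x. v + A *v x) ` insert 0 Basis = insert v ((\<lambda>i. v + column i A) ` UNIV)"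
    unfolding B by (simp add: image_image matrix_vector_mult_basis)
  moreover have "(\<lambda>x. v + A *v x) ` std = convex hull ((\<lambda>x. v + A *v x) ` insert 0 Basis)"
    unfolding std_def image_image[of "(+) v" "(*v) A", symmetric]
    by (simp only: convex_hull_translation convex_hull_linear_image[OF matrix_vector_mul_linear])
  moreover have "measure lebesgue ((\<lambda>x. v + A *v x) ` std) = \<bar>det A\<bar> / fact CARD('n)"
    unfolding image_image[of "(+) v" "(*v) A", symmetric]
    using measurable_and_measure_linear_image[OF matrix_vector_mul_linear std(1), of A] std(2)
    by (simp add: measure_translation)
  ultimately show ?thesis by simp
qed

section \<open>Bases of lattices\<close>

definition int_vecs :: "(real^'n) set" where
  "int_vecs = {z. \<forall>i. z $ i \<in> \<int>}"

definition int_matrix :: "real^'n^'m \<Rightarrow> bool" where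
  "int_matrix K \<longleftrightarrow> (\<forall>i j. K $ i $ j \<in> \<int>)"

lemma int_vecs_0 [simp]: "0 \<in> int_vecs"
  and int_vecs_add: "x \<in> int_vecs \<Longrightarrow> y \<in> int_vecs \<Longrightarrow> x + y \<in> int_vecs"
  and int_vecs_diff: "x \<in> int_vecs \<Longrightarrow> y \<in> int_vecs \<Longrightarrow> x - y \<in> int_vecs"
  and int_vecs_axis [simp]: "axis i 1 \<in> int_vecs"
  and int_vecs_column: "int_matrix K \<Longrightarrow> column i K \<in> int_vecs"
  by (auto simp: int_vecs_def int_matrix_def axis_def column_def)

lemma det_int_matrix: "int_matrix K \<Longrightarrow> det K \<in> \<int>"
  by (auto simp: det_def int_matrix_def intro!: Ints_sum Ints_mult Ints_prod)

lemma uniform_discrete_int_vecs: "uniform_discrete (int_vecs :: (real^'n) set)"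
proof (rule uniformI1)
  fix x y :: "real^'n" assume xy: "x \<in> int_vecs" "y \<in> int_vecs" "dist x y < 1"
  have "\<bar>x $ i - y $ i\<bar> < 1" for i
    using component_le_norm_cart[of "x - y" i] xy(3) by (simp add: dist_norm)
  then have "x $ i = y $ i" for i
    using xy(1,2) Ints_nonzero_abs_less1[of "x $ i - y $ i"] by (auto simp: int_vecs_def)
  then show "x = y" by (simp add: vec_eq_iff)
qed simp

text \<open>An injective linear map is bounded below, so the integer vectors in question form a
  bounded uniformly discrete set.\<close>

lemma finite_int_vecs_image:
  fixes T :: "real^'n \<Rightarrow> real^'n"
  assumes "linear T" "inj T"
  shows "finite {z \<in> int_vecs. norm (T z) \<le> r}"
proof -
  obtain e where e: "e > 0" "\<And>x. e * norm x \<le> norm (T x)"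
    using linear_inj_bounded_below_pos[OF assms] by blast
  have "norm z \<le> r / e" if "norm (T z) \<le> r" for z
    using e(2)[of z] that e(1) by (simp add: pos_le_divide_eq mult.commute)
  then have "bounded {z \<in> int_vecs. norm (T z) \<le> r}"
    by (intro boundedI[of _ "r / e"]) auto
  moreover have "uniform_discrete {z \<in> int_vecs. norm (T z) \<le> r}"
    by (rule uniform_discrete_subset[OF uniform_discrete_int_vecs]) auto
  ultimately show ?thesis
    using uniform_discrete_finite_iff by blast
qed

lemma column_mult: "column j (A ** B) = A *v column j B"
  by (simp add: column_def matrix_matrix_mult_def matrix_vector_mult_def vec_eq_iff)

lemma matrix_eq_columns: "A = B \<longleftrightarrow> (\<forall>j. column j A = column j B)"
  by (auto simp: vec_eq_iff column_def)

lemma det_scaleR: "det (c *\<^sub>R A) = c ^ CARD('n) * det A" for A :: "real^'n^'n"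
proof -
  have "c *\<^sub>R A = (\<chi> i. c *s A $ i)"
    by (simp add: vec_eq_iff)
  then show ?thesis
    by (simp add: det_rows_mul)
qed

text \<open>Turns membership of the columns in the lattice generated by \<open>B\<close> into a
  matrix factorization, so that determinants can be compared.\<close>

lemma int_matrix_factor:
  fixes A B :: "real^'n^'n"
  assumes "\<And>j. \<exists>z\<in>int_vecs. column j A = B *v z"
  obtains K where "int_matrix K" "A = B ** K"
proof -
  obtain z where z: "\<And>j. z j \<in> int_vecs" "\<And>j. column j A = B *v z j"
    using assms by metis
  define K where "K = (\<chi> i j. z j $ i)"
  have "column j K = z j" for j
    by (simp add: K_def column_def vec_eq_iff)
  then have "A = B ** K"
    by (simp add: matrix_eq_columns column_mult z)
  moreover have "int_matrix K"
    using z(1) by (simp add: K_def int_matrix_def int_vecs_def)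
  ultimately show ?thesis using that by blast
qed

lemma lattice_basis_alt: "lattice_basis \<Lambda> B \<longleftrightarrow> invertible B \<and> \<Lambda> = (*v) B ` int_vecs"
  by (auto simp: lattice_basis_def int_vecs_def image_def)

text \<open>Each of two bases is an integer matrix multiple of the other. The determinant of that
  factor is a nonzero integer, which gives both inequalities.\<close>

lemma lattice_det_eq:
  assumes B: "lattice_basis \<Lambda> B"
  shows "lattice_det \<Lambda> = \<bar>det B\<bar>"
proof -
  have le: "\<bar>det B\<bar> \<le> \<bar>det C\<bar>" if "lattice_basis \<Lambda> B" "lattice_basis \<Lambda> C" for B C
  proof -
    have "\<exists>z\<in>int_vecs. column j C = B *v z" for j
      using that by (auto simp: lattice_basis_alt matrix_vector_mult_basis[symmetric] set_eq_iff image_iff)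
    then obtain K where K: "int_matrix K" "C = B ** K"
      by (rule int_matrix_factor)
    have "det C \<noteq> 0"
      using that by (simp add: lattice_basis_def invertible_det_nz)
    then have "1 \<le> \<bar>det K\<bar>"
      using K det_int_matrix[of K] by (intro Ints_nonzero_abs_ge1) (auto simp: det_mul)
    then show ?thesis
      using mult_left_mono[of 1 "\<bar>det K\<bar>" "\<bar>det B\<bar>"] by (simp add: K det_mul abs_mult)
  qed
  show ?thesis
    unfolding lattice_det_def using B le by (intro the_equality) (blast intro: antisym)+
qed

text \<open>\<open>B\<close> is bounded below as a linear map, so it carries the uniform gap between
  integer vectors over to \<Lambda>; its columns span the whole space.\<close>

lemma lattice_basis_imp_lattice_in:
  assumes "lattice_basis \<Lambda> B"
  shows "lattice_in \<Lambda>"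
  unfolding lattice_in_def
proof (intro conjI ballI)
  have inv: "invertible B" and \<Lambda>: "\<Lambda> = (*v) B ` int_vecs"
    using assms by (auto simp: lattice_basis_alt)
  have lin: "linear ((*v) B)" and inj: "inj ((*v) B)"
    using inv by (auto simp: inj_matrix_vector_mult)
  show "0 \<in> \<Lambda>"
    unfolding \<Lambda> by (rule image_eqI[of _ _ 0]) auto
  show "x - y \<in> \<Lambda>" if "x \<in> \<Lambda>" "y \<in> \<Lambda>" for x y
    using that unfolding \<Lambda>
    by (auto simp: matrix_vector_mult_diff_distrib[symmetric] intro!: imageI int_vecs_diff)
  obtain e where e: "e > 0" "\<And>x. e * norm x \<le> norm (B *v x)"
    using linear_inj_bounded_below_pos[OF lin inj] by blast
  obtain d where d: "d > 0" "\<And>x y. x \<in> int_vecs \<Longrightarrow> y \<in> int_vecs \<Longrightarrow> dist x y < d \<Longrightarrow> x = (y::real^'a)"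
    using uniform_discrete_int_vecs unfolding uniform_discrete_def by blast
  have "x = y" if "x \<in> int_vecs" "y \<in> int_vecs" "dist (B *v x) (B *v y) < e * d" for x y
  proof (rule d(2)[OF that(1,2)])
    have "e * dist x y < e * d"
      using that(3) e(2)[of "x - y"] by (simp add: dist_norm matrix_vector_mult_diff_distrib)
    then show "dist x y < d" using e(1) by simp
  qed
  then have "uniform_discrete \<Lambda>"
    unfolding \<Lambda> using e(1) d(1) by (intro uniformI1[of "e * d"]) auto
  then show "discrete \<Lambda>"
    by (rule uniform_discrete_imp_discrete)
  have "span (columns B) = UNIV"
    using inv matrix_right_invertible_span_columns[of B] unfolding invertible_def span_vec_eq by blast
  moreover have "columns B \<subseteq> \<Lambda>"
    unfolding \<Lambda> columns_def by (auto simp: matrix_vector_mult_basis[symmetric])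
  ultimately have "span \<Lambda> = UNIV"
    using span_mono by blast
  then show "dim \<Lambda> = CARD('a)"
    by (metis dim_span dim_UNIV DIM_cart DIM_real mult.right_neutral)
qed

section \<open>Group structure of a lattice and existence of a basis\<close>

context
  fixes \<Lambda> :: "(real^'n) set"
  assumes \<Lambda>: "lattice_in \<Lambda>"
begin

lemma lattice_diff: "x \<in> \<Lambda> \<Longrightarrow> y \<in> \<Lambda> \<Longrightarrow> x - y \<in> \<Lambda>"
  using \<Lambda> by (simp add: lattice_in_def)

lemma lattice_0: "0 \<in> \<Lambda>"
  using \<Lambda> by (simp add: lattice_in_def)

lemma lattice_add: "x \<in> \<Lambda> \<Longrightarrow> y \<in> \<Lambda> \<Longrightarrow> x + y \<in> \<Lambda>"
  using lattice_diff[of x "0 - y"] lattice_diff[OF lattice_0] by auto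

lemma lattice_sum: "(\<And>i. i \<in> I \<Longrightarrow> f i \<in> \<Lambda>) \<Longrightarrow> sum f I \<in> \<Lambda>"
  by (induction I rule: infinite_finite_induct) (auto intro: lattice_0 lattice_add)

lemma lattice_of_nat_scale: "x \<in> \<Lambda> \<Longrightarrow> of_nat k *\<^sub>R x \<in> \<Lambda>"
  by (induction k) (auto simp: scaleR_left_distrib intro: lattice_0 lattice_add)

lemma lattice_scale: "k \<in> \<int> \<Longrightarrow> x \<in> \<Lambda> \<Longrightarrow> k *\<^sub>R x \<in> \<Lambda>"
proof (elim Ints_cases)
  fix m assume k: "k = of_int m" and x: "x \<in> \<Lambda>"
  show ?thesis
  proof (cases m rule: int_cases2)
    case (nonneg n)
    then show ?thesis using lattice_of_nat_scale[OF x, of n] k by simp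
  next
    case (nonpos n)
    then show ?thesis using lattice_diff[OF lattice_0 lattice_of_nat_scale[OF x, of n]] k by simp
  qed
qed

lemma lattice_matrix_mult:
  assumes "\<And>j. column j A \<in> \<Lambda>" "z \<in> int_vecs"
  shows "A *v z \<in> \<Lambda>"
  unfolding matrix_mult_sum scalar_mult_eq_scaleR
  using assms by (intro lattice_sum lattice_scale) (auto simp: int_vecs_def)

text \<open>Taking differences moves the gap around the origin to every lattice point.\<close>

lemma lattice_uniform_discrete: "uniform_discrete \<Lambda>"
proof -
  have "0 isolated_in \<Lambda>"
    using \<Lambda> by (simp add: lattice_in_def discrete_def)
  then obtain d where d: "d > 0" "\<And>y. y \<in> \<Lambda> \<Longrightarrow> dist 0 y < d \<Longrightarrow> y = 0"
    by (rule isolated_inE_dist) blast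
  show ?thesis
  proof (rule uniformI1[OF d(1)])
    show "x = y" if "x \<in> \<Lambda>" "y \<in> \<Lambda>" "dist x y < d" for x y
      using d(2)[OF lattice_diff[OF that(1,2)]] that(3) by (simp add: dist_norm norm_minus_commute)
  qed
qed

lemma lattice_independent_matrix:
  obtains A where "\<And>j. column j A \<in> \<Lambda>" "det A \<noteq> 0"
proof -
  obtain S where S: "S \<subseteq> \<Lambda>" "independent S" "card S = dim \<Lambda>"
    using basis_exists by metis
  have c: "card S = CARD('n)"
    using S(3) \<Lambda> by (simp add: lattice_in_def)
  then have "finite S" by (intro card_ge_0_finite) simp
  then obtain h where h: "bij_betw h (UNIV :: 'n set) S"
    using finite_same_card_bij[of "UNIV :: 'n set" S] c by auto
  define A where "A = (\<chi> i j. h j $ i)"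
  have col: "column j A = h j" for j
    by (simp add: A_def column_def vec_eq_iff)
  have "columns A = S"
    using h by (auto simp: columns_def col bij_betw_def)
  moreover have "dim S = DIM(real^'n)"
    using dim_eq_card_independent[OF S(2)] c by simp
  ultimately have "span (columns A) = UNIV"
    using dim_eq_full by blast
  then have "invertible A"
    using matrix_right_invertible_span_columns[of A] invertible_right_inverse span_vec_eq by metis
  then have "det A \<noteq> 0"
    by (simp add: invertible_det_nz)
  moreover have "column j A \<in> \<Lambda>" for j
    using h S(1) by (auto simp: col bij_betw_def)
  ultimately show ?thesis using that by blast
qed

text \<open>Pigeonhole among the finitely many lattice points in the fundamental parallelepiped of \<open>A\<close>.\<close>
lemma lattice_common_denominator:
  assumes A: "\<And>j. column j A \<in> \<Lambda>" "det A \<noteq> 0"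
  obtains N :: nat where "N > 0" "\<And>x. x \<in> \<Lambda> \<Longrightarrow> \<exists>z\<in>int_vecs. of_nat N *\<^sub>R x = A *v z"
proof -
  obtain A' where "A ** A' = mat 1"
    using A(2) by (auto simp: invertible_right_inverse simp flip: invertible_det_nz)
  then have AA: "A *v (A' *v x) = x" for x
    by (simp add: matrix_vector_mul_assoc)
  define F where "F = \<Lambda> \<inter> (*v) A ` cbox 0 1"
  have "bounded ((*v) A ` cbox 0 1)"
    by (intro bounded_linear_image bounded_cbox) simp
  then have "finite F"
    using uniform_discrete_finite_iff[of F] lattice_uniform_discrete
    unfolding F_def by (metis bounded_Int uniform_discrete_subset inf_le1)
  define fl :: "real^'n \<Rightarrow> real^'n" where "fl t = (\<chi> i. of_int \<lfloor>t $ i\<rfloor>)" for t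
  have fl: "fl t \<in> int_vecs" for t
    by (simp add: fl_def int_vecs_def)
  \<comment> \<open>Reduction modulo the sublattice generated by the columns of \<open>A\<close>,
    into the fundamental parallelepiped.\<close>
  define g where "g x = x - A *v fl (A' *v x)" for x
  have g: "g x \<in> F" if "x \<in> \<Lambda>" for x
  proof -
    define t where "t = A' *v x"
    have "g x = A *v (t - fl t)"
      unfolding g_def t_def by (simp add: matrix_vector_mult_diff_distrib AA)
    moreover have "t - fl t \<in> cbox 0 1"
      by (simp add: mem_box_cart fl_def) (intro allI conjI; linarith)
    moreover have "g x \<in> \<Lambda>"
      unfolding g_def by (intro lattice_diff that lattice_matrix_mult A fl)
    ultimately show ?thesis unfolding F_def by auto
  qed
  have "\<exists>z\<in>int_vecs. of_nat (fact (card F)) *\<^sub>R x = A *v z" if x: "x \<in> \<Lambda>" for x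
  proof -
    define h where "h k = g (of_nat k *\<^sub>R x)" for k :: nat
    have "h ` {..card F} \<subseteq> F"
      using g lattice_of_nat_scale[OF x] by (auto simp: h_def)
    \<comment> \<open>The interval \<open>{..card F}\<close> contains 0, hence has one element more
      than \<open>F\<close>.\<close>
    then have "card (h ` {..card F}) < card {..card F}"
      using card_mono[OF \<open>finite F\<close>] by (simp add: less_Suc_eq_le)
    then have "\<not> inj_on h {..card F}"
      using card_image by fastforce
    then obtain k l where kl: "k < l" "l \<le> card F" "h k = h l"
      unfolding inj_on_def by (metis atMost_iff linorder_neqE_nat)
    define d where "d = l - k"
    have d: "1 \<le> d" "d \<le> card F" using kl by (auto simp: d_def)
    \<comment> \<open>The multiplier \<open>d\<close> depends on \<open>x\<close> but never exceeds
      \<open>card F\<close>, so the factorial serves all \<open>x\<close> at once.\<close>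
    have "d dvd (fact (card F) :: nat)"
      using dvd_fact[OF d] .
    then obtain q where q: "fact (card F) = d * (q :: nat)" by blast
    define z where "z = fl (A' *v (of_nat l *\<^sub>R x)) - fl (A' *v (of_nat k *\<^sub>R x))"
    have "of_nat l *\<^sub>R x - of_nat k *\<^sub>R x = A *v z"
      using kl(3) by (simp add: h_def g_def z_def matrix_vector_mult_diff_distrib algebra_simps)
    then have "of_nat d *\<^sub>R x = A *v z"
      using kl(1) by (simp add: d_def of_nat_diff scaleR_left_diff_distrib)
    then have "of_nat (fact (card F)) *\<^sub>R x = A *v (of_nat q *\<^sub>R z)"
      by (metis q of_nat_mult mult.commute scaleR_scaleR matrix_vector_mult_scaleR)
    moreover have "of_nat q *\<^sub>R z \<in> int_vecs"
      using fl by (auto simp: z_def int_vecs_def)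
    ultimately show ?thesis by blast
  qed
  then show ?thesis
    using that[of "fact (card F)"] by simp
qed

text \<open>A tuple of lattice vectors of minimal nonzero determinant is a basis: by Cramer's rule,
  exchanging a vector for one with a fractional coordinate would decrease the determinant.\<close>
lemma lattice_basis_exists: obtains B where "lattice_basis \<Lambda> B"
proof -
  obtain A where A: "\<And>j. column j A \<in> \<Lambda>" "det A \<noteq> 0"
    using lattice_independent_matrix by blast
  obtain N :: nat where N: "N > 0" "\<And>x. x \<in> \<Lambda> \<Longrightarrow> \<exists>z\<in>int_vecs. of_nat N *\<^sub>R x = A *v z"
    using lattice_common_denominator[OF A] by blast
  define P where "P C \<longleftrightarrow> (\<forall>j. column j C \<in> \<Lambda>) \<and> det C \<noteq> 0" for C
  \<comment> \<open>With this scaling every admissible determinant becomes a natural number in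
    absolute value, so a minimal one exists.\<close>
  define s where "s = real N ^ CARD('n) / \<bar>det A\<bar>"
  have s: "s > 0" using A(2) N(1) by (simp add: s_def)
  have int: "s * \<bar>det C\<bar> \<in> \<int>" if "P C" for C
  proof -
    have *: "column j (of_nat N *\<^sub>R C) = of_nat N *\<^sub>R column j C" for j
      by (simp add: column_def vec_eq_iff)
    have "\<exists>z\<in>int_vecs. column j (of_nat N *\<^sub>R C) = A *v z" for j
      unfolding * using that N(2) by (simp add: P_def)
    then obtain K where K: "int_matrix K" "of_nat N *\<^sub>R C = A ** K"
      by (rule int_matrix_factor)
    have "real N ^ CARD('n) * det C = det A * det K"
      using K(2) by (metis det_mul det_scaleR of_nat_id)
    then have "\<bar>det A * det K\<bar> = real N ^ CARD('n) * \<bar>det C\<bar>"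
      by (metis abs_mult abs_of_nonneg of_nat_0_le_iff zero_le_power)
    then have "s * \<bar>det C\<bar> = \<bar>det K\<bar>"
      using A(2) by (simp add: s_def abs_mult field_simps)
    then show ?thesis using det_int_matrix[OF K(1)] by simp
  qed
  define m where "m C = nat \<lfloor>s * \<bar>det C\<bar>\<rfloor>" for C :: "real^'n^'n"
  have m: "real (m C) = s * \<bar>det C\<bar>" if "P C" for C
    using int[OF that] s by (auto simp: m_def elim!: Ints_cases)
  have "P A" using A by (simp add: P_def)
  then obtain C where C: "P C" "\<And>D. P D \<Longrightarrow> m C \<le> m D"
    using ex_has_least_nat[of P A m] by blast
  have min: "\<bar>det C\<bar> \<le> \<bar>det D\<bar>" if "P D" for D
    using C(2)[OF that] s by (simp add: m[OF that] m[OF C(1)] flip: of_nat_le_iff[where 'a=real])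
  have inv: "invertible C" using C(1) by (simp add: P_def invertible_det_nz)
  then obtain C' where C': "C ** C' = mat 1"
    using invertible_right_inverse by blast
  have "\<Lambda> \<subseteq> (*v) C ` int_vecs"
  proof
    fix x assume x: "x \<in> \<Lambda>"
    define t where "t = C' *v x"
    define z :: "real^'n" where "z = (\<chi> i. of_int \<lfloor>t $ i\<rfloor>)"
    have z: "z \<in> int_vecs" by (simp add: z_def int_vecs_def)
    have Ct: "C *v t = x"
      by (simp add: t_def matrix_vector_mul_assoc C')
    define y where "y = x - C *v z"
    have y: "y = C *v (t - z)"
      by (simp add: y_def matrix_vector_mult_diff_distrib Ct)
    have y\<Lambda>: "y \<in> \<Lambda>"
      unfolding y_def using C(1) z by (intro lattice_diff x lattice_matrix_mult) (auto simp: P_def)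
    have "(t - z) $ k = 0" for k
    proof (rule ccontr)
      assume nz: "(t - z) $ k \<noteq> 0"
      define D where "D = (\<chi> i j. if j = k then (C *v (t - z)) $ i else C $ i $ j)"
      have det: "det D = (t - z) $ k * det C"
        unfolding D_def by (rule cramer_lemma)
      have "column j D = (if j = k then y else column j C)" for j
        by (simp add: D_def column_def vec_eq_iff y)
      then have "P D"
        using C(1) y\<Lambda> nz det by (simp add: P_def)
      then have "\<bar>det C\<bar> \<le> \<bar>(t - z) $ k\<bar> * \<bar>det C\<bar>"
        using min[of D] det by (simp add: abs_mult)
      moreover have "\<bar>(t - z) $ k\<bar> < 1"
        by (simp add: z_def) linarith
      moreover have "\<bar>det C\<bar> > 0" using C(1) by (simp add: P_def)
      ultimately show False by (simp add: mult_le_cancel_right1)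
    qed
    then have "t = z" by (simp add: vec_eq_iff)
    then show "x \<in> (*v) C ` int_vecs" using Ct z by auto
  qed
  moreover have "(*v) C ` int_vecs \<subseteq> \<Lambda>"
    using C(1) lattice_matrix_mult by (auto simp: P_def)
  ultimately have "lattice_basis \<Lambda> C"
    using inv by (auto simp: lattice_basis_alt)
  then show ?thesis using that by blast
qed

end

section \<open>Delone simplices in lattice coordinates\<close>

text \<open>The power of the point \<open>T z\<close> with respect to the sphere with center \<open>c\<close> through the origin.\<close>
definition sphere_power :: "(real^'n \<Rightarrow> real^'n) \<Rightarrow> real^'n \<Rightarrow> real^'n \<Rightarrow> real" where
  "sphere_power T c z = T z \<bullet> T z - 2 * (T z \<bullet> c)"

text \<open>The lattice is the image of the integer vectors under \<open>T\<close>, one vertex of the simplex is the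
  origin, and the columns of \<open>K\<close> are the integer coordinates of the other vertices. The relative volume
  is then \<open>\<bar>det K\<bar>\<close>.\<close>
definition delone_coords :: "(real^'n \<Rightarrow> real^'n) \<Rightarrow> real^'n \<Rightarrow> real^'n^'n \<Rightarrow> bool" where
  "delone_coords T c K \<longleftrightarrow> linear T \<and> inj T \<and> int_matrix K \<and> det K \<noteq> 0 \<and>
     (\<forall>i. sphere_power T c (column i K) = 0) \<and>
     (\<forall>z\<in>int_vecs. z \<noteq> 0 \<longrightarrow> z \<notin> columns K \<longrightarrow> sphere_power T c z > 0)"

lemma sphere_power_eq_norm: "sphere_power T c z = (norm (T z - c))\<^sup>2 - (norm c)\<^sup>2"
  by (simp add: sphere_power_def power2_norm_eq_inner inner_diff inner_commute)

lemma sphere_power_sgn: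
  "sphere_power T c z = 0 \<longleftrightarrow> norm (T z - c) = norm c"
  "sphere_power T c z > 0 \<longleftrightarrow> norm (T z - c) > norm c"
  unfolding sphere_power_eq_norm
  by (simp add: power2_eq_iff_nonneg)
    (smt (verit) norm_ge_zero power_less_imp_less_base power_strict_mono zero_less_numeral)

lemma invertible_imp_inj: "invertible A \<Longrightarrow> inj ((*v) A)" for A :: "real^'n^'n"
  using inj_matrix_vector_mult by auto

text \<open>The vertices are the image of \<open>insert 0 Basis\<close> under an injective affine
  map.\<close>

lemma invertible_simplex_vertices:
  fixes M :: "real^'n^'n" and v :: "real^'n"
  assumes "invertible M"
  defines "V \<equiv> insert v ((\<lambda>i. v + column i M) ` UNIV)"
  shows "card V = CARD('n) + 1" "\<not> affine_dependent V"
proof -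
  have inj: "inj ((*v) M)" using assms(1) by (rule invertible_imp_inj)
  have B: "(Basis :: (real^'n) set) = (\<lambda>i. axis i 1) ` UNIV"
    by (auto simp: Basis_vec_def)
  have V: "V = (\<lambda>x. v + M *v x) ` insert 0 Basis"
    unfolding V_def B by (simp add: image_image matrix_vector_mult_basis)
  have "inj (\<lambda>x. v + M *v x)"
    using inj by (auto simp: inj_def)
  then have "card V = card (insert 0 (Basis :: (real^'n) set))"
    unfolding V by (intro card_image inj_on_subset[OF \<open>inj (\<lambda>x. v + M *v x)\<close>]) simp
  also have "\<dots> = CARD('n) + 1"
    by (simp add: nonzero_Basis)
  finally show "card V = CARD('n) + 1" .
  have "independent (range (\<lambda>i. column i M))"
    using linear_independent_injective_image[OF matrix_vector_mul_linear independent_Basis inj_on_subset[OF inj]]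
    unfolding B by (simp add: image_image matrix_vector_mult_basis)
  moreover have "v \<notin> range (\<lambda>i. v + column i M)"
    using injD[OF inj, of 0 "axis _ 1"] by (auto simp: matrix_vector_mult_basis axis_eq_0_iff)
  ultimately show "\<not> affine_dependent V"
    unfolding V_def by (simp add: affine_dependent_iff_dependent image_image)
qed

text \<open>The lattice is the image of \<open>int_vecs\<close> under \<open>T\<close>. Since the
  circumsphere passes through the origin, its radius is \<open>norm c\<close>, and signs of
  \<open>sphere_power\<close> decide the position of lattice points.\<close>

lemma delone_coords_realized:
  fixes K :: "real^'n^'n"
  assumes "delone_coords T c K"
  shows "\<exists>(\<Lambda> :: (real^'n) set) L. lattice_in \<Lambda> \<and> delone_simplex \<Lambda> L \<and> \<bar>det K\<bar> = relative_volume \<Lambda> L"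
proof -
  have T: "linear T" "inj T" and K: "int_matrix K" "det K \<noteq> 0"
    and zero: "\<And>i. sphere_power T c (column i K) = 0"
    and pos: "\<And>z. z \<in> int_vecs \<Longrightarrow> z \<noteq> 0 \<Longrightarrow> z \<notin> columns K \<Longrightarrow> sphere_power T c z > 0"
    using assms by (auto simp: delone_coords_def)
  define B where "B = matrix T"
  have TB: "T z = B *v z" for z
    unfolding B_def using T(1) by (simp add: matrix_works)
  have detB: "det B \<noteq> 0"
    using T unfolding B_def by (simp add: det_nz_iff_inj)
  define M where "M = B ** K"
  have detM: "det M = det B * det K" by (simp add: M_def det_mul)
  then have invM: "invertible M"
    using detB K by (simp add: invertible_det_nz)
  have colM: "column i M = T (column i K)" for i
    by (simp add: M_def column_mult TB)
  define \<Lambda> where "\<Lambda> = (*v) B ` int_vecs"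
  have basis: "lattice_basis \<Lambda> B"
    using detB by (simp add: lattice_basis_alt \<Lambda>_def invertible_det_nz)
  define V where "V = insert 0 ((\<lambda>i. 0 + column i M) ` UNIV)"
  have V: "card V = CARD('n) + 1" "\<not> affine_dependent V"
    unfolding V_def by (rule invertible_simplex_vertices[OF invM])+
  have V_image: "V = T ` insert 0 (columns K)"
    unfolding V_def by (auto simp: colM columns_def linear_0[OF T(1)])
  have "columns K \<subseteq> int_vecs"
    using int_vecs_column[OF K(1)] by (auto simp: columns_def)
  then have "V \<subseteq> \<Lambda>"
    unfolding V_image \<Lambda>_def TB by (intro image_mono) simp
  \<comment> \<open>With \<open>c = 0\<close>, a vertex of power zero would be the origin itself,
    and \<open>M\<close> would have a zero column.\<close>
  moreover have "norm c > 0"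
  proof (rule ccontr)
    assume "\<not> norm c > 0"
    then have "T (column undefined K) = 0"
      using zero[of undefined] by (simp add: sphere_power_def)
    then have "column undefined M = 0" by (simp add: colM)
    then have "det M = 0" by (rule det_zero_column)
    then show False using invM by (simp add: invertible_det_nz)
  qed
  moreover have "norm (v - c) = norm c" if "v \<in> V" for v
    using that zero unfolding V_image by (auto simp: sphere_power_sgn columns_def linear_0[OF T(1)])
  moreover have "norm (v - c) > norm c" if v: "v \<in> \<Lambda> - V" for v
  proof -
    obtain z where z: "z \<in> int_vecs" "v = T z"
      using v unfolding \<Lambda>_def TB by auto
    moreover have "z \<noteq> 0" "z \<notin> columns K"
      using v z unfolding V_image by auto
    ultimately show ?thesis using pos by (simp add: sphere_power_sgn)
  qed
  ultimately have "delone_simplex \<Lambda> (convex hull V)"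
    unfolding delone_simplex_def using V by blast
  moreover have "relative_volume \<Lambda> (convex hull V) = \<bar>det K\<bar>"
    unfolding relative_volume_def V_def measure_simplex lattice_det_eq[OF basis]
    using detB by (simp add: detM abs_mult)
  ultimately show ?thesis
    using lattice_basis_imp_lattice_in[OF basis] by metis
qed

text \<open>Converse of \<open>delone_coords_realized\<close>: translate one vertex
  \<open>v0\<close> to the origin and write the edge vectors there in a lattice basis.\<close>

lemma delone_simplex_coords:
  fixes \<Lambda> :: "(real^'n) set"
  assumes \<Lambda>: "lattice_in \<Lambda>" and "delone_simplex \<Lambda> L"
  shows "\<exists>T c (K :: real^'n^'n). delone_coords T c K \<and> relative_volume \<Lambda> L = \<bar>det K\<bar>"
proof -
  obtain V c r where V: "V \<subseteq> \<Lambda>" "card V = CARD('n) + 1" "\<not> affine_dependent V" "L = convex hull V"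
    and r: "\<forall>v\<in>V. norm (v - c) = r" "\<forall>v\<in>\<Lambda> - V. norm (v - c) > r"
    using assms(2) unfolding delone_simplex_def by blast
  obtain B where B: "lattice_basis \<Lambda> B"
    using lattice_basis_exists[OF \<Lambda>] .
  then have invB: "invertible B" and \<Lambda>B: "\<Lambda> = (*v) B ` int_vecs"
    by (auto simp: lattice_basis_alt)
  have "finite V" using V(2) by (intro card_ge_0_finite) simp
  obtain v0 where v0: "v0 \<in> V" using V(2) by fastforce
  have "card (V - {v0}) = CARD('n)" using V(2) v0 \<open>finite V\<close> by simp
  then obtain f where f: "bij_betw f (UNIV :: 'n set) (V - {v0})"
    using finite_same_card_bij[of "UNIV :: 'n set" "V - {v0}"] \<open>finite V\<close> by auto
  define M where "M = (\<chi> i j. f j $ i - v0 $ i)"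
  have colM: "column j M = f j - v0" for j
    by (simp add: M_def column_def vec_eq_iff)
  have "V = insert v0 (range f)"
    using f v0 by (auto simp: bij_betw_def)
  then have VM: "V = insert v0 ((\<lambda>i. v0 + column i M) ` UNIV)"
    by (simp add: colM)
  have "\<exists>z\<in>int_vecs. column j M = B *v z" for j
  proof -
    have "f j \<in> \<Lambda>" using f V(1) by (auto simp: bij_betw_def)
    then have "f j - v0 \<in> \<Lambda>"
      using lattice_diff[OF \<Lambda>] v0 V(1) by auto
    then show ?thesis unfolding colM \<Lambda>B by auto
  qed
  then obtain K where K: "int_matrix K" "M = B ** K"
    by (rule int_matrix_factor)
  have colK: "B *v column j K = column j M" for j
    by (simp add: K column_mult)
  \<comment> \<open>Affine independence of the vertices becomes linear independence of the edge
    vectors, and hence invertibility of \<open>M\<close>.\<close>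
  have indep: "independent (range (\<lambda>j. column j M))" and injM: "inj (\<lambda>j. column j M)"
  proof -
    have "V - {v0} = range f"
      using f by (simp add: bij_betw_def)
    then have "(\<lambda>x. - v0 + x) ` (V - {v0}) = range (\<lambda>j. column j M)"
      by (simp add: colM image_image)
    then show "independent (range (\<lambda>j. column j M))"
      using V(3) affine_dependent_iff_dependent2[OF v0] by simp
    show "inj (\<lambda>j. column j M)"
      using f by (auto simp: bij_betw_def colM inj_def)
  qed
  have "dim (columns M) = DIM(real^'n)"
  proof -
    have "columns M = range (\<lambda>j. column j M)" by (auto simp: columns_def)
    then show ?thesis
      using dim_eq_card_independent[OF indep] card_image[OF injM] by simp
  qed
  then have "span (columns M) = UNIV"
    using dim_eq_full by blast
  then have "invertible M"
    using matrix_right_invertible_span_columns[of M] invertible_right_inverse span_vec_eq by metis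
  then have detM: "det B * det K \<noteq> 0"
    by (simp add: invertible_det_nz K det_mul)
  define c' where "c' = c - v0"
  have nc: "norm c' = r"
    unfolding c'_def using r(1) v0 by (simp add: norm_minus_commute[of c])
  have shift: "norm (B *v z - c') = norm (v0 + B *v z - c)" for z
    by (simp add: c'_def algebra_simps)
  have "sphere_power ((*v) B) c' (column i K) = 0" for i
    unfolding sphere_power_sgn shift nc unfolding colK using VM by (intro r(1)[rule_format]) auto
  moreover have "sphere_power ((*v) B) c' z > 0" if z: "z \<in> int_vecs" "z \<noteq> 0" "z \<notin> columns K" for z
    unfolding sphere_power_sgn shift nc
  proof (rule r(2)[rule_format, OF DiffI])
    show "v0 + B *v z \<in> \<Lambda>"
      using lattice_add[OF \<Lambda>] z(1) v0 V(1) \<Lambda>B by auto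
    have inj: "inj ((*v) B)" using invB by (rule invertible_imp_inj)
    have "B *v z \<noteq> B *v 0" "B *v z \<noteq> B *v column i K" for i
      unfolding inj_eq[OF inj] using z by (auto simp: columns_def)
    then show "v0 + B *v z \<notin> V"
      unfolding VM by (auto simp: colK)
  qed
  ultimately have "delone_coords ((*v) B) c' K"
    unfolding delone_coords_def using K(1) detM invertible_imp_inj[OF invB] by auto
  moreover have "relative_volume \<Lambda> L = \<bar>det K\<bar>"
    unfolding relative_volume_def V(4) VM measure_simplex lattice_det_eq[OF B]
    using detM by (simp add: K det_mul abs_mult)
  ultimately show ?thesis by blast
qed

definition delone_dets :: "'n::finite itself \<Rightarrow> real set" where
  "delone_dets _ = {\<bar>det K\<bar> |T c (K :: real^'n^'n). delone_coords T c K}"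

lemma mv_eq_Greatest: "mv TYPE('n::finite) = (GREATEST m. m \<in> delone_dets TYPE('n))"
  unfolding mv_def
proof (rule arg_cong[of _ _ Greatest], rule ext)
  fix m
  show "(\<exists>(\<Lambda> :: (real^'n) set) L. lattice_in \<Lambda> \<and> delone_simplex \<Lambda> L \<and> m = relative_volume \<Lambda> L) \<longleftrightarrow>
      m \<in> delone_dets TYPE('n)"
    unfolding delone_dets_def using delone_simplex_coords delone_coords_realized by fastforce
qed

section \<open>Existence of the maximum\<close>

lemma sphere_power_0 [simp]: "linear T \<Longrightarrow> sphere_power T c 0 = 0"
  by (simp add: sphere_power_def linear_0)

lemma delone_coords_nonneg:
  assumes "delone_coords T c K" "z \<in> int_vecs"
  shows "sphere_power T c z \<ge> 0"
  using assms unfolding delone_coords_def columns_def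
  by (cases "z = 0"; cases "z \<in> columns K") (auto simp: columns_def intro: less_imp_le)

lemma linear_matrix_mult_columns:
  assumes "linear T"
  shows "T (K *v l) = (\<Sum>i\<in>UNIV. l $ i *\<^sub>R T (column i K))"
  unfolding matrix_mult_sum scalar_mult_eq_scaleR
  by (simp add: linear_sum[OF assms] linear_scale[OF assms])

text \<open>If \<open>u\<close> is a lattice vector then \<open>w + u\<close> and \<open>w - u\<close> lie outside the open circumball for every
  vertex \<open>w\<close>, which bounds \<open>u \<bullet> (w - c)\<close> by \<open>u \<bullet> u / 2\<close>.\<close>
lemma delone_coords_no_short_vector:
  fixes K :: "real^'n^'n"
  assumes D: "delone_coords T c K" and u: "K *v l \<in> int_vecs" and l: "(\<Sum>i\<in>UNIV. \<bar>l $ i\<bar>) < 1"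
  shows "K *v l = 0"
proof (rule ccontr)
  define u where "u = K *v l"
  assume "K *v l \<noteq> 0"
  have T: "linear T" "inj T" and K: "int_matrix K"
    and zero: "\<And>i. sphere_power T c (column i K) = 0"
    using D by (auto simp: delone_coords_def)
  have Tu: "T u \<noteq> 0"
    using \<open>K *v l \<noteq> 0\<close> T linear_injective_0[OF T(1)] by (auto simp: u_def)
  have bnd: "\<bar>2 * (T u \<bullet> (T w - c))\<bar> \<le> T u \<bullet> T u" if w: "w \<in> int_vecs" "sphere_power T c w = 0" for w
  proof -
    have "sphere_power T c (w + u) \<ge> 0" "sphere_power T c (w - u) \<ge> 0"
      using w(1) u by (auto simp: u_def intro!: delone_coords_nonneg[OF D] int_vecs_add int_vecs_diff)
    with w(2) show ?thesis
      by (simp add: sphere_power_def linear_add[OF T(1)] linear_diff[OF T(1)] inner_add inner_diff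
          inner_commute algebra_simps abs_le_iff)
  qed
  \<comment> \<open>The bounds for the vertex 0 and for the vertex \<open>column i K\<close> are
    subtracted, which cancels \<open>c\<close>.\<close>
  have abs: "\<bar>T u \<bullet> T (column i K)\<bar> \<le> T u \<bullet> T u" for i
    using bnd[of 0] bnd[OF int_vecs_column[OF K] zero, of i]
    by (simp add: T linear_0 inner_diff_right)
  have le: "l $ i * (T u \<bullet> T (column i K)) \<le> \<bar>l $ i\<bar> * (T u \<bullet> T u)" for i
  proof -
    have "l $ i * (T u \<bullet> T (column i K)) \<le> \<bar>l $ i\<bar> * \<bar>T u \<bullet> T (column i K)\<bar>"
      by (simp flip: abs_mult)
    also have "\<dots> \<le> \<bar>l $ i\<bar> * (T u \<bullet> T u)"
      by (intro mult_left_mono abs) simp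
    finally show ?thesis .
  qed
  have "T u \<bullet> T u = T u \<bullet> (\<Sum>i\<in>UNIV. l $ i *\<^sub>R T (column i K))"
    by (simp add: u_def linear_matrix_mult_columns[OF T(1)])
  also have "\<dots> = (\<Sum>i\<in>UNIV. l $ i * (T u \<bullet> T (column i K)))"
    by (simp add: inner_sum_right)
  also have "\<dots> \<le> (\<Sum>i\<in>UNIV. \<bar>l $ i\<bar>) * (T u \<bullet> T u)"
    unfolding sum_distrib_right by (intro sum_mono le)
  also have "\<dots> < T u \<bullet> T u"
    using l Tu by simp
  finally show False by simp
qed

text \<open>Cut \<open>S\<close> along the unit cells and move all pieces into the unit cube. Pieces
  that met would come from two points of \<open>S\<close> with integer difference, so they are
  disjoint and their total volume is at most 1.\<close>

lemma blichfeldt: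
  fixes S :: "(real^'n) set"
  assumes S: "bounded S" "S \<in> lmeasurable" and inj: "\<And>x y. x \<in> S \<Longrightarrow> y \<in> S \<Longrightarrow> x - y \<in> int_vecs \<Longrightarrow> x = y"
  shows "measure lebesgue S \<le> 1"
proof -
  define fl :: "real^'n \<Rightarrow> real^'n" where "fl x = (\<chi> i. of_int \<lfloor>x $ i\<rfloor>)" for x
  have fl: "x - fl x \<in> cbox 0 1" for x
    by (simp add: mem_box_cart fl_def) (intro allI conjI; linarith)
  define Z where "Z = fl ` S"
  have Z: "Z \<subseteq> int_vecs"
    by (auto simp: Z_def fl_def int_vecs_def)
  have "bounded ((\<lambda>(x, y). x - y) ` (S \<times> cbox (0::real^'n) 1))"
    by (intro bounded_minus S bounded_cbox)
  moreover have "Z \<subseteq> (\<lambda>(x, y). x - y) ` (S \<times> cbox 0 1)"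
    unfolding Z_def using fl by (force intro!: image_eqI[of _ _ "(x, x - fl x)" for x])
  ultimately have "bounded Z" by (rule bounded_subset)
  then have "finite Z"
    using uniform_discrete_finite_iff uniform_discrete_subset[OF uniform_discrete_int_vecs Z] by blast
  define U where "U z = (+) (- z) ` S \<inter> cbox 0 1" for z
  have U: "U z \<in> lmeasurable" for z
    unfolding U_def by (intro fmeasurable.Int measurable_translation S) simp
  have disj: "U z \<inter> U w = {}" if zw: "z \<in> Z" "w \<in> Z" "z \<noteq> w" for z w
  proof (rule ccontr)
    assume "U z \<inter> U w \<noteq> {}"
    then obtain x y where xy: "x \<in> S" "y \<in> S" "- z + x = - w + y"
      unfolding U_def by auto
    then have "x - y = z - w" by (simp add: algebra_simps)
    then have "x = y" using inj[OF xy(1,2)] int_vecs_diff Z zw by auto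
    with xy(3) zw(3) show False by simp
  qed
  have "S \<subseteq> (\<Union>z\<in>Z. (+) z ` U z)"
  proof
    fix x assume "x \<in> S"
    then have "fl x \<in> Z" "- fl x + x \<in> U (fl x)"
      using fl[of x] by (auto simp: Z_def U_def)
    moreover have "x = fl x + (- fl x + x)" by simp
    ultimately show "x \<in> (\<Union>z\<in>Z. (+) z ` U z)" by blast
  qed
  then have "measure lebesgue S \<le> measure lebesgue (\<Union>z\<in>Z. (+) z ` U z)"
    using S \<open>finite Z\<close> U by (intro measure_mono_fmeasurable fmeasurable.finite_UN measurable_translation) auto
  also have "\<dots> \<le> (\<Sum>z\<in>Z. measure lebesgue ((+) z ` U z))"
    using \<open>finite Z\<close> U by (intro measure_UNION_le) (auto intro!: fmeasurableD measurable_translation)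
  also have "\<dots> = (\<Sum>z\<in>Z. measure lebesgue (U z))"
    by (simp add: measure_translation)
  also have "\<dots> = measure lebesgue (\<Union>(U ` Z))"
    using \<open>finite Z\<close> U disj
    by (intro measure_negligible_finite_Union_image[symmetric]) (auto simp: pairwise_def)
  also have "\<dots> \<le> measure lebesgue (cbox 0 (1::real^'n))"
    using \<open>finite Z\<close> U by (intro measure_mono_fmeasurable fmeasurableD fmeasurable.finite_UN) (auto simp: U_def)
  also have "\<dots> = 1"
    by (simp add: content_cbox_if_cart interval_eq_empty_cart)
  finally show ?thesis .
qed

text \<open>Two points of a cube of side \<open>1 / n\<close> differ by a vector of absolute
  coordinate sum below 1. So the image of the cube under \<open>K\<close> has no two points with
  integer difference, and its volume \<open>\<bar>det K\<bar> / n ^ n\<close> is at most 1.\<close>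

lemma delone_coords_det_bound:
  fixes K :: "real^'n^'n"
  assumes D: "delone_coords T c K"
  shows "\<bar>det K\<bar> \<le> real CARD('n) ^ CARD('n)"
proof -
  define n where "n = real CARD('n)"
  have n: "n > 0" by (simp add: n_def)
  \<comment> \<open>The box is open, which makes the coordinate differences strictly smaller than
    \<open>1 / n\<close>.\<close>
  define C where "C = box 0 (\<chi> i. 1 / n :: real^'n)"
  have C: "bounded C" "C \<in> lmeasurable" by (auto simp: C_def)
  have "measure lebesgue C = (1 / n) ^ CARD('n)"
  proof -
    have "measure lebesgue C = measure lebesgue (cbox 0 (\<chi> i. 1 / n :: real^'n))"
      by (simp add: C_def measure_lborel_box_eq measure_lborel_cbox_eq)
    then show ?thesis
      using n by (simp add: content_cbox_if_cart interval_eq_empty_cart)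
  qed
  then have KC: "(*v) K ` C \<in> lmeasurable" "measure lebesgue ((*v) K ` C) = \<bar>det K\<bar> * (1 / n) ^ CARD('n)"
    using measurable_and_measure_linear_image[OF matrix_vector_mul_linear C(2), of K] by simp_all
  have "measure lebesgue ((*v) K ` C) \<le> 1"
  proof (rule blichfeldt[OF _ KC(1)])
    show "bounded ((*v) K ` C)"
      by (intro bounded_linear_image C) simp
    fix x y assume "x \<in> (*v) K ` C" "y \<in> (*v) K ` C" and xy: "x - y \<in> int_vecs"
    then obtain p q where pq: "p \<in> C" "q \<in> C" "x = K *v p" "y = K *v q" by auto
    have "\<bar>(p - q) $ i\<bar> < 1 / n" for i
      using pq(1,2) by (simp add: C_def mem_box_cart) (smt (verit))
    then have "(\<Sum>i\<in>UNIV. \<bar>(p - q) $ i\<bar>) < (\<Sum>i\<in>(UNIV :: 'n set). 1 / n)"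
      by (intro sum_strict_mono) auto
    then have "(\<Sum>i\<in>UNIV. \<bar>(p - q) $ i\<bar>) < 1"
      using n by (simp add: n_def)
    then have "K *v (p - q) = 0"
      using xy by (intro delone_coords_no_short_vector[OF D]) (simp_all add: pq matrix_vector_mult_diff_distrib)
    then show "x = y"
      by (simp add: pq matrix_vector_mult_diff_distrib)
  qed
  then show ?thesis
    using n by (simp add: KC(2) power_one_over field_simps flip: n_def)
qed

section \<open>A Delone simplex in every dimension\<close>

lemma Ints_square_minus_self:
  fixes x :: real
  assumes "x \<in> \<int>"
  shows "0 \<le> x\<^sup>2 - x" "x\<^sup>2 - x = 0 \<Longrightarrow> x = 0 \<or> x = 1"
proof -
  obtain m where m: "x = of_int m" using assms by (auto elim: Ints_cases)
  have "m \<le> m\<^sup>2"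
    by (cases "m \<le> 0") (auto intro: order_trans[OF _ zero_le_power2] self_le_power)
  then have "of_int m \<le> (of_int (m\<^sup>2) :: real)" by (simp only: of_int_le_iff)
  then show "0 \<le> x\<^sup>2 - x" by (simp add: m)
  show "x = 0 \<or> x = 1" if "x\<^sup>2 - x = 0"
    using that by (simp add: power2_eq_square)
qed

text \<open>The standard simplex is a Delone simplex of \<open>\<int>\<^sup>n\<close> for every quadratic form
  \<open>\<Sum> z\<^sub>i\<^sup>2 + s (\<Sum> z\<^sub>i)\<^sup>2\<close> with \<open>s > 0\<close>; here \<open>s = n + 2\<close>.\<close>
lemma delone_coords_standard:
  defines "n \<equiv> real CARD('n::finite)"
  shows "delone_coords (\<lambda>z::real^'n. z + (\<Sum>i\<in>UNIV. z $ i) *\<^sub>R 1) (((n + 3) / (2 * (n + 1))) *\<^sub>R 1) (mat 1)"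
    (is "delone_coords ?T ?c _")
proof -
  have n: "n > 0" by (simp add: n_def)
  have in1: "x \<bullet> 1 = (\<Sum>i\<in>UNIV. x $ i)" for x :: "real^'n"
    by (simp add: inner_vec_def)
  have 11: "(1 :: real^'n) \<bullet> 1 = n"
    by (simp add: in1 n_def)
  \<comment> \<open>The map \<open>?T\<close> adds \<open>(n + 2) s\<^sup>2\<close> to the squared
    norm, where \<open>s\<close> is the coordinate sum. The center is scaled so that the linear term
    is \<open>(n + 3) s\<close>, which splits as \<open>s + (n + 2) s\<close>.\<close>
  have Q: "sphere_power ?T ?c z = (\<Sum>i\<in>UNIV. (z $ i)\<^sup>2 - z $ i) + (n + 2) * ((\<Sum>i\<in>UNIV. z $ i)\<^sup>2 - (\<Sum>i\<in>UNIV. z $ i))" for z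
  proof -
    define s where "s = (\<Sum>i\<in>UNIV. z $ i)"
    have zz: "z \<bullet> z = (\<Sum>i\<in>UNIV. (z $ i)\<^sup>2)"
      by (simp add: inner_vec_def power2_eq_square)
    have z1: "z \<bullet> 1 = s" "1 \<bullet> z = s"
      by (simp_all add: in1 s_def inner_commute[of 1])
    have "sphere_power ?T ?c z = z \<bullet> z + (n + 2) * s\<^sup>2 - 2 * ((n + 3) / (2 * (n + 1))) * ((n + 1) * s)"
      unfolding sphere_power_def s_def[symmetric]
      by (simp add: inner_add z1 11 power2_eq_square algebra_simps)
    also have "2 * ((n + 3) / (2 * (n + 1))) * ((n + 1) * s) = (n + 3) * s"
      using n by (simp add: field_simps)
    finally show ?thesis
      by (simp add: zz sum_subtractf s_def algebra_simps)
  qed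
  have col: "column i (mat 1) = (axis i 1 :: real^'n)" for i
    by (simp add: column_def mat_def axis_def vec_eq_iff)
  have "linear ?T"
    by (rule linearI) (simp_all add: sum.distrib scaleR_left_distrib sum_distrib_left[symmetric] algebra_simps)
  moreover have "inj ?T"
  proof (rule linear_injective_0[OF \<open>linear ?T\<close>, THEN iffD2], intro allI impI)
    fix z assume z: "?T z = 0"
    have "(n + 1) * (\<Sum>i\<in>UNIV. z $ i) = ?T z \<bullet> 1"
      by (simp only: inner_add_left inner_scaleR_left 11 in1[of z]) (simp add: algebra_simps)
    then have "(n + 1) * (\<Sum>i\<in>UNIV. z $ i) = 0"
      by (simp only: z inner_zero_left)
    then have "(\<Sum>i\<in>UNIV. z $ i) = 0" using n by simp
    then show "z = 0" using z by simp
  qed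
  moreover have "int_matrix (mat 1 :: real^'n^'n)"
    by (simp add: int_matrix_def mat_def)
  moreover have "sphere_power ?T ?c (column i (mat 1)) = 0" for i
    unfolding Q col by (simp add: axis_def if_distrib[of "\<lambda>x. x\<^sup>2"] cong: if_cong)
  moreover have "sphere_power ?T ?c z > 0"
    if z: "z \<in> int_vecs" "z \<noteq> 0" "z \<notin> columns (mat 1)" for z
  proof (rule ccontr)
    assume neg: "\<not> sphere_power ?T ?c z > 0"
    define s where "s = (\<Sum>i\<in>UNIV. z $ i)"
    have zi: "z $ i \<in> \<int>" for i using z(1) by (simp add: int_vecs_def)
    then have s: "s \<in> \<int>" by (simp add: s_def Ints_sum)
    have 1: "0 \<le> (\<Sum>i\<in>UNIV. (z $ i)\<^sup>2 - z $ i)"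
      using Ints_square_minus_self(1)[OF zi] by (intro sum_nonneg) auto
    moreover have 2: "0 \<le> (n + 2) * (s\<^sup>2 - s)"
      using Ints_square_minus_self(1)[OF s] n by simp
    \<comment> \<open>Both summands must vanish. So all coordinates and their sum are 0 or 1, and a
      nonzero \<open>z\<close> has exactly one coordinate 1.\<close>
    ultimately have "(\<Sum>i\<in>UNIV. (z $ i)\<^sup>2 - z $ i) = 0" "(n + 2) * (s\<^sup>2 - s) = 0"
      using neg unfolding Q s_def[symmetric] by linarith+
    then have "(z $ i)\<^sup>2 - z $ i = 0" "s\<^sup>2 - s = 0" for i
      using Ints_square_minus_self(1)[OF zi] n by (simp_all add: sum_nonneg_eq_0_iff)
    then have z01: "z $ i = 0 \<or> z $ i = 1" and s01: "s = 0 \<or> s = 1" for i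
      using Ints_square_minus_self(2) zi s by auto
    obtain k where k: "z $ k = 1"
      using z(2) z01 by (metis vec_eq_iff zero_index)
    have rest0: "0 \<le> z $ i" for i using z01[of i] by auto
    have "s = z $ k + (\<Sum>i\<in>UNIV - {k}. z $ i)"
      unfolding s_def by (rule sum.remove) auto
    moreover have "0 \<le> (\<Sum>i\<in>UNIV - {k}. z $ i)"
      by (intro sum_nonneg rest0)
    ultimately have "(\<Sum>i\<in>UNIV - {k}. z $ i) = 0"
      using s01 k by linarith
    then have "z $ i = 0" if "i \<noteq> k" for i
      using that rest0 by (simp add: sum_nonneg_eq_0_iff)
    then have "z = column k (mat 1)"
      unfolding col by (auto simp: vec_eq_iff axis_def k)
    then show False using z(3) by (auto simp: columns_def)
  qed
  ultimately show ?thesis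
    unfolding delone_coords_def by simp
qed

text \<open>The determinants are integers of bounded absolute value and at least one occurs, so
  \<open>GREATEST\<close> is the maximum of a finite nonempty set.\<close>

lemma mv_greatest:
  shows "mv TYPE('n::finite) \<in> delone_dets TYPE('n)"
    and "m \<in> delone_dets TYPE('n) \<Longrightarrow> m \<le> mv TYPE('n)"
proof -
  let ?S = "delone_dets TYPE('n)"
  have "?S \<subseteq> {k \<in> \<int>. \<bar>k\<bar> \<le> real CARD('n) ^ CARD('n)}"
    using delone_coords_det_bound det_int_matrix
    by (fastforce simp: delone_dets_def delone_coords_def)
  then have fin: "finite ?S"
    using finite_abs_int_segment finite_subset by blast
  have ne: "?S \<noteq> {}"
    using delone_coords_standard unfolding delone_dets_def by blast
  have "mv TYPE('n) = Max ?S"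
    unfolding mv_eq_Greatest using fin ne by (intro Greatest_equality) auto
  then show "mv TYPE('n) \<in> ?S" "m \<in> ?S \<Longrightarrow> m \<le> mv TYPE('n)"
    using fin ne by auto
qed

section \<open>Products\<close>

text \<open>Up to relabelling of indices, the block diagonal matrix of \<open>A\<close> and an
  identity. A product of two of these, for injections with complementary ranges, is block diagonal
  with both given blocks.\<close>

definition embed_matrix :: "('a \<Rightarrow> 'c) \<Rightarrow> real^'a^'a \<Rightarrow> real^'c^'c" where
  "embed_matrix f A = (\<chi> i j. if i \<in> range f \<and> j \<in> range f then A $ inv f i $ inv f j else of_bool (i = j))"

context
  fixes f :: "'a::finite \<Rightarrow> 'c::finite"
  assumes inj: "inj f"
begin

lemma embed_matrix_nth:
  "embed_matrix f A $ f i $ f j = A $ i $ j"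
  "k \<notin> range f \<Longrightarrow> embed_matrix f A $ k $ l = of_bool (k = l)"
  "k \<notin> range f \<Longrightarrow> embed_matrix f A $ l $ k = of_bool (l = k)"
  using inj by (simp_all add: embed_matrix_def)

lemma embed_matrix_eqI:
  assumes "\<And>i j. B $ f i $ f j = A $ i $ j"
    and "\<And>k l. k \<notin> range f \<Longrightarrow> B $ k $ l = of_bool (k = l)"
    and "\<And>k l. k \<notin> range f \<Longrightarrow> B $ l $ k = of_bool (l = k)"
  shows "B = embed_matrix f A"
proof -
  have "B $ k $ l = embed_matrix f A $ k $ l" for k l
    by (cases "k \<in> range f"; cases "l \<in> range f") (auto simp: assms embed_matrix_nth)
  then show ?thesis by (simp add: vec_eq_iff)
qed

lemma sum_range_split: "(\<Sum>k\<in>UNIV. h k) = (\<Sum>i\<in>UNIV. h (f i)) + (\<Sum>k\<in>- range f. h k)" for h :: "'c \<Rightarrow> real"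
proof -
  have "(\<Sum>k\<in>UNIV. h k) = (\<Sum>k\<in>range f. h k) + (\<Sum>k\<in>- range f. h k)"
    using sum.subset_diff[of "range f" UNIV h] by (simp add: Compl_eq_Diff_UNIV add.commute)
  then show ?thesis by (simp add: sum.reindex[OF inj])
qed

lemma embed_matrix_mult: "embed_matrix f (A ** B) = embed_matrix f A ** embed_matrix f B"
proof (rule embed_matrix_eqI[symmetric])
  show "(embed_matrix f A ** embed_matrix f B) $ f i $ f j = (A ** B) $ i $ j" for i j
  proof -
    have "(\<Sum>k\<in>- range f. embed_matrix f A $ f i $ k * embed_matrix f B $ k $ f j) = 0"
      by (intro sum.neutral) (auto simp: embed_matrix_nth)
    then show ?thesis
      by (simp add: matrix_matrix_mult_def sum_range_split embed_matrix_nth)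
  qed
  show "(embed_matrix f A ** embed_matrix f B) $ k $ l = of_bool (k = l)" if "k \<notin> range f" for k l
    using that by (simp add: matrix_matrix_mult_def embed_matrix_nth of_bool_def if_distrib[of "\<lambda>x. x * _"] cong: if_cong)
  show "(embed_matrix f A ** embed_matrix f B) $ l $ k = of_bool (l = k)" if "k \<notin> range f" for k l
    using that by (simp add: matrix_matrix_mult_def embed_matrix_nth of_bool_def if_distrib[of "\<lambda>x. _ * x"] cong: if_cong)
qed

text \<open>Embedding is multiplicative and preserves the type of each elementary matrix, so
  induction over elementary matrices applies.\<close>

lemma det_embed_matrix: "det (embed_matrix f A) = det A"
proof (rule induct_matrix_elementary_alt[of _ A])
  show "det (embed_matrix f (A ** B)) = det (A ** B)"
    if "det (embed_matrix f A) = det A" "det (embed_matrix f B) = det B" for A B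
    using that by (simp add: embed_matrix_mult det_mul)
next
  fix A :: "real^'a^'a" and i assume A: "row i A = 0"
  then have Ai: "A $ i $ j = 0" for j by (simp add: row_def vec_eq_iff)
  have "embed_matrix f A $ f i $ k = 0" for k
    by (cases "k \<in> range f") (auto simp: embed_matrix_nth Ai)
  then have "row (f i) (embed_matrix f A) = 0"
    by (simp add: row_def vec_eq_iff)
  then show "det (embed_matrix f A) = det A"
    using A det_zero_row(2) by metis
next
  fix A :: "real^'a^'a" assume A: "\<And>i j. i \<noteq> j \<Longrightarrow> A $ i $ j = 0"
  have "embed_matrix f A $ k $ l = 0" if "k \<noteq> l" for k l
    using that by (cases "k \<in> range f"; cases "l \<in> range f") (auto simp: embed_matrix_nth A inj_eq[OF inj])
  then have "det (embed_matrix f A) = (\<Prod>k\<in>UNIV. embed_matrix f A $ k $ k)"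
    by (rule det_diagonal)
  also have "\<dots> = (\<Prod>k\<in>range f. embed_matrix f A $ k $ k)"
    by (intro prod.mono_neutral_right) (auto simp: embed_matrix_nth)
  also have "\<dots> = det A"
    by (simp add: prod.reindex[OF inj] embed_matrix_nth det_diagonal[OF A])
  finally show "det (embed_matrix f A) = det A" .
next
  fix m n :: 'a assume mn: "m \<noteq> n"
  have "embed_matrix f (\<chi> i j. mat 1 $ i $ Transposition.transpose m n j)
      = (\<chi> i j. mat 1 $ i $ Transposition.transpose (f m) (f n) j)"
    using inj by (intro embed_matrix_eqI[symmetric]) (auto simp: mat_def Transposition.transpose_def inj_eq)
  then show "det (embed_matrix f (\<chi> i j. mat 1 $ i $ Transposition.transpose m n j))
      = det (\<chi> i j. mat 1 $ i $ Transposition.transpose m n j)"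
    using det_swap[OF mn] det_swap[of "f m" "f n"] mn inj by (simp add: inj_eq)
next
  fix m n :: 'a assume mn: "m \<noteq> n"
  have "embed_matrix f (\<chi> i j. of_bool (i = m \<and> j = n \<or> i = j))
      = (\<chi> i j. of_bool (i = f m \<and> j = f n \<or> i = j))"
    using inj by (intro embed_matrix_eqI[symmetric]) (auto simp: inj_eq)
  then show "det (embed_matrix f (\<chi> i j. of_bool (i = m \<and> j = n \<or> i = j)))
      = det (\<chi> i j. of_bool (i = m \<and> j = n \<or> i = j))"
    using det_shear[OF mn] det_shear[of "f m" "f n"] mn inj by (simp add: inj_eq)
qed

lemma int_matrix_embed: "int_matrix A \<Longrightarrow> int_matrix (embed_matrix f A)"
  by (auto simp: int_matrix_def embed_matrix_def)

end

text \<open>Only finitely many integer vectors have power at most 1, so the positive powers have a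
  positive lower bound. This is the room for the perturbation.\<close>

lemma delone_coords_gap:
  assumes D: "delone_coords T c K"
  shows "\<exists>d>0. \<forall>z\<in>int_vecs. z = 0 \<or> z \<in> columns K \<or> d \<le> sphere_power T c z"
proof -
  define P where "P = {z \<in> int_vecs. z \<noteq> 0 \<and> z \<notin> columns K \<and> sphere_power T c z \<le> 1}"
  have "norm (T z) \<le> 1 + 2 * norm c" if "sphere_power T c z \<le> 1" for z
  proof -
    have "(norm (T z - c))\<^sup>2 \<le> 1 + (norm c)\<^sup>2"
      using that by (simp add: sphere_power_eq_norm)
    also have "\<dots> \<le> (1 + norm c)\<^sup>2"
      by (simp add: power2_sum)
    finally have "norm (T z - c) \<le> 1 + norm c"
      by (rule power2_le_imp_le) simp
    then show ?thesis
      using norm_triangle_ineq[of "T z - c" c] by simp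
  qed
  then have "P \<subseteq> {z \<in> int_vecs. norm (T z) \<le> 1 + 2 * norm c}"
    by (auto simp: P_def)
  then have fin: "finite P"
    using finite_int_vecs_image[of T] D unfolding delone_coords_def by (meson finite_subset)
  \<comment> \<open>The inserted 1 keeps the set nonempty and accounts for all points of power above
    1.\<close>
  define d where "d = Min (insert 1 (sphere_power T c ` P))"
  have "d > 0"
    using fin D by (auto simp: d_def P_def delone_coords_def)
  moreover have "z = 0 \<or> z \<in> columns K \<or> d \<le> sphere_power T c z" if "z \<in> int_vecs" for z
  proof (cases "sphere_power T c z \<le> 1")
    case True
    then have "z = 0 \<or> z \<in> columns K \<or> z \<in> P" using that by (auto simp: P_def)
    then show ?thesis using fin by (auto simp: d_def intro: Min_le)
  next
    case False
    then show ?thesis using fin by (auto simp: d_def intro: Min_le order_trans[of _ 1])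
  qed
  ultimately show ?thesis by blast
qed

text \<open>Supplies the functionals \<alpha> and \<beta>: the edge vectors are the columns of an
  invertible \<open>M\<close>, so the system with matrix \<open>transpose M\<close> and the all-ones
  right-hand side is solvable.\<close>

lemma delone_coords_dual_vector:
  assumes D: "delone_coords T c K"
  shows "\<exists>a. \<forall>i. a \<bullet> T (column i K) = 1"
proof -
  define M where "M = matrix T ** K"
  have "det M \<noteq> 0"
    using D unfolding delone_coords_def by (simp add: M_def det_mul det_nz_iff_inj)
  then have "invertible (transpose M)"
    by (simp add: invertible_det_nz)
  then obtain N where "transpose M ** N = mat 1"
    using invertible_right_inverse by blast
  then have N: "transpose M *v (N *v 1) = 1"
    by (simp add: matrix_vector_mul_assoc)
  have "(N *v 1) \<bullet> T (column i K) = 1" for i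
  proof -
    have "T (column i K) = column i M"
      using D by (simp add: M_def column_mult matrix_works delone_coords_def)
    then have "(N *v 1) \<bullet> T (column i K) = (transpose M *v (N *v 1)) $ i"
      by (simp add: inner_vec_def matrix_vector_mult_def transpose_def column_def mult.commute)
    then show ?thesis by (simp only: N one_index)
  qed
  then show ?thesis by blast
qed

text \<open>The cross term grows at most like the squared norms, and these are controlled by the
  powers up to a constant. One \<open>C\<close> therefore works for all of the infinitely many
  lattice points.\<close>

lemma delone_coords_cross_term_bound:
  assumes D1: "delone_coords T1 c1 K1" and D2: "delone_coords T2 c2 K2"
  shows "\<exists>C\<ge>0. \<forall>x\<in>int_vecs. \<forall>y\<in>int_vecs.
    \<bar>2 * (a \<bullet> T1 x) * (b \<bullet> T2 y)\<bar> \<le> C * (sphere_power T1 c1 x + sphere_power T2 c2 y + 1)"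
proof -
  define C where "C = norm a * norm b * (2 + 4 * (norm c1)\<^sup>2 + 4 * (norm c2)\<^sup>2)"
  have "\<bar>2 * (a \<bullet> T1 x) * (b \<bullet> T2 y)\<bar> \<le> C * (sphere_power T1 c1 x + sphere_power T2 c2 y + 1)"
    if xy: "x \<in> int_vecs" "y \<in> int_vecs" for x y
  proof -
    define X Y where "X = T1 x" and "Y = T2 y"
    define s where "s = sphere_power T1 c1 x + sphere_power T2 c2 y"
    have s: "s \<ge> 0"
      using delone_coords_nonneg[OF D1 xy(1)] delone_coords_nonneg[OF D2 xy(2)] by (simp add: s_def)
    have sq: "(norm v)\<^sup>2 \<le> 2 * (norm (v - w))\<^sup>2 + 2 * (norm w)\<^sup>2" for v w :: "real^'m"
    proof -
      have "norm v \<le> norm (v - w) + norm w"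
        using norm_triangle_ineq[of "v - w" w] by simp
      then have "(norm v)\<^sup>2 \<le> (norm (v - w) + norm w)\<^sup>2"
        by (intro power_mono) auto
      also have "\<dots> \<le> 2 * (norm (v - w))\<^sup>2 + 2 * (norm w)\<^sup>2"
        using sum_squares_bound[of "norm (v - w)" "norm w"] by (simp add: power2_sum)
      finally show ?thesis .
    qed
    \<comment> \<open>By \<open>sq\<close>, a squared norm is at most twice the power plus four
      times the squared norm of the center.\<close>
    have XY: "2 * (norm X * norm Y) \<le> 2 * s + 4 * (norm c1)\<^sup>2 + 4 * (norm c2)\<^sup>2"
      using sum_squares_bound[of "norm X" "norm Y"] sq[of X c1] sq[of Y c2]
      by (simp add: s_def X_def Y_def sphere_power_eq_norm)
    have "\<bar>2 * (a \<bullet> X) * (b \<bullet> Y)\<bar> = 2 * (\<bar>a \<bullet> X\<bar> * \<bar>b \<bullet> Y\<bar>)"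
      by (simp add: abs_mult)
    also have "\<dots> \<le> 2 * ((norm a * norm X) * (norm b * norm Y))"
      by (intro mult_left_mono mult_mono Cauchy_Schwarz_ineq2) auto
    also have "\<dots> = norm a * norm b * (2 * (norm X * norm Y))"
      by (simp add: algebra_simps)
    also have "\<dots> \<le> norm a * norm b * ((2 + 4 * (norm c1)\<^sup>2 + 4 * (norm c2)\<^sup>2) * (s + 1))"
    proof (intro mult_left_mono order_trans[OF XY])
      have "0 \<le> s * (norm c1)\<^sup>2" "0 \<le> s * (norm c2)\<^sup>2" using s by auto
      then show "2 * s + 4 * (norm c1)\<^sup>2 + 4 * (norm c2)\<^sup>2 \<le> (2 + 4 * (norm c1)\<^sup>2 + 4 * (norm c2)\<^sup>2) * (s + 1)"
        by (simp add: algebra_simps)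
    qed auto
    also have "\<dots> = C * (s + 1)"
      by (simp add: C_def)
    finally show ?thesis by (simp add: X_def Y_def s_def)
  qed
  moreover have "C \<ge> 0" by (simp add: C_def)
  ultimately show ?thesis by blast
qed

text \<open>The quotient \<open>s / (s + 1)\<close> increases with \<open>s\<close>, so it is at
  least \<open>d / (1 + d)\<close>. Dividing this by \<open>B + 1\<close> gives a suitable
  \<open>e\<close>, also when \<open>B\<close> is 0.\<close>

lemma small_factor_exists:
  fixes B d :: real
  assumes "B \<ge> 0" "d > 0"
  obtains e where "e > 0" "e \<le> 1" "\<And>s. d \<le> s \<Longrightarrow> e * B * (s + 1) < s"
proof
  define e where "e = d / ((1 + d) * (B + 1))"
  have pos: "(1 + d) * (B + 1) > 0" using assms by simp
  show "e > 0" using assms by (simp add: e_def)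
  have "d * 1 \<le> (1 + d) * (B + 1)" using assms by (intro mult_mono) auto
  then show "e \<le> 1" using pos by (simp add: e_def)
  fix s assume s: "d \<le> s"
  have "(d * (s + 1)) * B \<le> (s * (1 + d)) * B"
    using s assms by (intro mult_right_mono) (auto simp: algebra_simps)
  also have "\<dots> < (s * (1 + d)) * (B + 1)"
    using s assms by (intro mult_strict_left_mono) auto
  finally show "e * B * (s + 1) < s"
    using pos by (simp add: e_def pos_divide_less_eq mult_ac)
qed

section \<open>The orthogonal sum and its shear\<close>

context
  fixes f :: "'a::finite \<Rightarrow> 'c::finite" and g :: "'b::finite \<Rightarrow> 'c"
  assumes inj_f: "inj f" and inj_g: "inj g" and range_g: "range g = - range f"
begin

text \<open>The pair \<open>(x, y)\<close> as a vector indexed by \<open>'c\<close>, through the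
  decomposition of \<open>'c\<close> into the ranges of \<open>f\<close> and
  \<open>g\<close>.\<close>

definition join :: "real^'a \<Rightarrow> real^'b \<Rightarrow> real^'c" where
  "join x y = (\<chi> k. if k \<in> range f then x $ inv f k else y $ inv g k)"

lemma f_neq_g: "f i \<noteq> g j"
  using range_g by auto

lemma join_nth [simp]: "join x y $ f i = x $ i" "join x y $ g j = y $ j"
  using inj_f inj_g f_neq_g by (auto simp: join_def) (metis f_neq_g)

lemma index_cases: obtains i where "k = f i" | j where "k = g j"
proof -
  have "k \<in> range f \<union> range g" using range_g by simp
  then show thesis using that by blast
qed

lemma vec_split_eq_iff: "z = w \<longleftrightarrow> (\<forall>i. z $ f i = w $ f i) \<and> (\<forall>j. z $ g j = w $ g j)" for z w :: "real^'c"
  by (metis index_cases vec_eq_iff)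

lemma sum_split: "(\<Sum>k\<in>UNIV. h k) = (\<Sum>i\<in>UNIV. h (f i)) + (\<Sum>j\<in>UNIV. h (g j))" for h :: "'c \<Rightarrow> real"
  unfolding sum_range_split[OF inj_f, of h] range_g[symmetric] by (simp add: sum.reindex[OF inj_g])

lemma inner_join: "join x y \<bullet> join x' y' = x \<bullet> x' + y \<bullet> y'"
  by (simp add: inner_vec_def sum_split)

lemma join_surj: obtains x y where "z = join x y"
proof
  show "z = join (\<chi> i. z $ f i) (\<chi> j. z $ g j)"
    by (simp add: vec_split_eq_iff)
qed

lemma join_eq_0_iff: "join x y = 0 \<longleftrightarrow> x = 0 \<and> y = 0"
  unfolding vec_split_eq_iff by (simp add: vec_eq_iff)

lemma join_int_vecs: "join x y \<in> int_vecs \<longleftrightarrow> x \<in> int_vecs \<and> y \<in> int_vecs"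
  unfolding int_vecs_def mem_Collect_eq by (metis index_cases join_nth)

lemma embed_matrix_mult_join:
  "embed_matrix f A *v join x y = join (A *v x) y"
  "embed_matrix g B *v join x y = join x (B *v y)"
proof -
  have fg: "f i \<notin> range g" "g j \<notin> range f" for i j
    using range_g by auto
  show "embed_matrix f A *v join x y = join (A *v x) y"
    unfolding vec_split_eq_iff
    by (simp add: matrix_vector_mult_def sum_split embed_matrix_nth inj_f fg f_neq_g f_neq_g[symmetric] inj_eq[OF inj_g])
  show "embed_matrix g B *v join x y = join x (B *v y)"
    unfolding vec_split_eq_iff
    by (simp add: matrix_vector_mult_def sum_split embed_matrix_nth inj_g fg f_neq_g f_neq_g[symmetric] inj_eq[OF inj_f])
qed

text \<open>The columns are the integer coordinates of the vertices \<open>(v\<^sub>i, 0)\<close>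
  and \<open>(0, w\<^sub>j)\<close>.\<close>

lemma column_embed_matrices:
  "column (f i) (embed_matrix f A ** embed_matrix g B) = join (column i A) 0"
  "column (g j) (embed_matrix f A ** embed_matrix g B) = join 0 (column j B)"
proof -
  have "axis (f i) 1 = join (axis i 1) 0" "axis (g j) 1 = join 0 (axis j 1)"
    unfolding vec_split_eq_iff
    by (auto simp: axis_def f_neq_g f_neq_g[symmetric] inj_eq[OF inj_f] inj_eq[OF inj_g])
  then show "column (f i) (embed_matrix f A ** embed_matrix g B) = join (column i A) 0"
    "column (g j) (embed_matrix f A ** embed_matrix g B) = join 0 (column j B)"
    by (simp_all add: embed_matrix_mult_join flip: matrix_vector_mult_basis matrix_vector_mul_assoc)
qed

text \<open>The new lattice is a shear of the orthogonal sum. The functionals \<open>a\<close> and \<open>b\<close> take only the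
  values 0 and 1 on the vertices, so the term \<open>(b \<bullet> Y)\<^sup>2 - b \<bullet> Y\<close> vanishes there, and \<open>c\<close> is chosen such
  that the power of a point is the sum of the two old powers plus \<open>2 e (a \<bullet> X) (b \<bullet> Y)\<close> plus
  \<open>e\<^sup>2 \<parallel>a\<parallel>\<^sup>2\<close> times this term.\<close>
lemma delone_coords_product:
  assumes D1: "delone_coords T1 c1 K1" and D2: "delone_coords T2 c2 K2"
  shows "\<exists>T c. delone_coords T c (embed_matrix f K1 ** embed_matrix g K2)"
proof -
  define K where "K = embed_matrix f K1 ** embed_matrix g K2"
  have T1: "linear T1" "inj T1" and K1: "int_matrix K1" "det K1 \<noteq> 0" and z1: "\<And>i. sphere_power T1 c1 (column i K1) = 0"
    using D1 by (auto simp: delone_coords_def)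
  have T2: "linear T2" "inj T2" and K2: "int_matrix K2" "det K2 \<noteq> 0" and z2: "\<And>i. sphere_power T2 c2 (column i K2) = 0"
    using D2 by (auto simp: delone_coords_def)
  obtain a where a: "\<And>i. a \<bullet> T1 (column i K1) = 1"
    using delone_coords_dual_vector[OF D1] by blast
  obtain b where b: "\<And>i. b \<bullet> T2 (column i K2) = 1"
    using delone_coords_dual_vector[OF D2] by blast
  obtain d1 where d1: "d1 > 0" "\<And>z. z \<in> int_vecs \<Longrightarrow> z = 0 \<or> z \<in> columns K1 \<or> d1 \<le> sphere_power T1 c1 z"
    using delone_coords_gap[OF D1] by blast
  obtain d2 where d2: "d2 > 0" "\<And>z. z \<in> int_vecs \<Longrightarrow> z = 0 \<or> z \<in> columns K2 \<or> d2 \<le> sphere_power T2 c2 z"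
    using delone_coords_gap[OF D2] by blast
  obtain C where C: "C \<ge> 0" "\<And>x y. x \<in> int_vecs \<Longrightarrow> y \<in> int_vecs \<Longrightarrow>
      \<bar>2 * (a \<bullet> T1 x) * (b \<bullet> T2 y)\<bar> \<le> C * (sphere_power T1 c1 x + sphere_power T2 c2 y + 1)"
    using delone_coords_cross_term_bound[OF D1 D2] by blast
  define d where "d = min d1 d2"
  have d: "d > 0" using d1 d2 by (simp add: d_def)
  define A where "A = a \<bullet> a"
  have A: "A \<ge> 0" by (simp add: A_def)
  obtain e where e: "e > 0" "e \<le> 1" "\<And>s. d \<le> s \<Longrightarrow> e * (C + A) * (s + 1) < s"
    using small_factor_exists[of "C + A" d] C(1) A d by auto
  \<comment> \<open>Adding the multiple of \<open>a\<close> to the first component creates the cross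
    term, together with the unwanted square
    \<open>e\<^sup>2 * A * (b \<bullet> T2 y)\<^sup>2\<close>.\<close>
  define T where "T z = (let x = (\<chi> i. z $ f i); y = (\<chi> j. z $ g j) in join (T1 x + (e * (b \<bullet> T2 y)) *\<^sub>R a) (T2 y))" for z
  \<comment> \<open>The correction along \<open>b\<close> cancels the linear term
    \<open>e * (a \<bullet> c1)\<close> caused by the shear and supplies the
    \<open>- b \<bullet> T2 y\<close> that makes the square term vanish on vertices.\<close>
  define c where "c = join c1 (c2 + (e\<^sup>2 * A / 2 - e * (a \<bullet> c1)) *\<^sub>R b)"
  have T: "T (join x y) = join (T1 x + (e * (b \<bullet> T2 y)) *\<^sub>R a) (T2 y)" for x y
    by (simp add: T_def)
  have Q: "sphere_power T c (join x y) = sphere_power T1 c1 x + sphere_power T2 c2 y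
      + 2 * e * (a \<bullet> T1 x) * (b \<bullet> T2 y) + e\<^sup>2 * A * ((b \<bullet> T2 y)\<^sup>2 - b \<bullet> T2 y)" for x y
    unfolding sphere_power_def T c_def inner_join
    by (simp add: inner_add A_def inner_commute power2_eq_square algebra_simps)
  have "linear T"
  proof (rule linearI)
    fix z w :: "real^'c" and r :: real
    have *: "(\<chi> i. (z + w) $ f i) = (\<chi> i. z $ f i) + (\<chi> i. w $ f i)" "(\<chi> i. (z + w) $ g i) = (\<chi> i. z $ g i) + (\<chi> i. w $ g i)"
      "(\<chi> i. (r *\<^sub>R z) $ f i) = r *\<^sub>R (\<chi> i. z $ f i)" "(\<chi> i. (r *\<^sub>R z) $ g i) = r *\<^sub>R (\<chi> i. z $ g i)"
      by (simp_all add: vec_eq_iff)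
    show "T (z + w) = T z + T w"
      unfolding T_def Let_def * vec_split_eq_iff
      by (simp add: linear_add[OF T1(1)] linear_add[OF T2(1)] inner_add algebra_simps)
    show "T (r *\<^sub>R z) = r *\<^sub>R T z"
      unfolding T_def Let_def * vec_split_eq_iff
      by (simp add: linear_scale[OF T1(1)] linear_scale[OF T2(1)] algebra_simps)
  qed
  moreover have "inj T"
  proof (rule linear_injective_0[OF \<open>linear T\<close>, THEN iffD2], intro allI impI)
    fix z assume Tz: "T z = 0"
    obtain x y where z: "z = join x y" by (rule join_surj)
    have "T1 x + (e * (b \<bullet> T2 y)) *\<^sub>R a = 0 \<and> T2 y = 0"
      using Tz unfolding z T join_eq_0_iff .
    then have "T1 x = 0" "T2 y = 0" by auto
    then have "x = 0" "y = 0"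
      using linear_injective_0[OF T1(1)] linear_injective_0[OF T2(1)] T1 T2 by auto
    then show "z = 0" by (simp add: z join_eq_0_iff)
  qed
  moreover have "int_matrix K"
    unfolding K_def int_matrix_def matrix_matrix_mult_def
    using int_matrix_embed[OF inj_f K1(1)] int_matrix_embed[OF inj_g K2(1)]
    by (auto simp: int_matrix_def intro!: Ints_sum Ints_mult)
  moreover have "det K \<noteq> 0"
    using K1 K2 by (simp add: K_def det_mul det_embed_matrix inj_f inj_g)
  moreover have "sphere_power T c (column k K) = 0" for k
    by (cases k rule: index_cases)
      (simp_all add: K_def column_embed_matrices Q z1 z2 T1 T2 linear_0 b)
  moreover have "sphere_power T c z > 0" if z: "z \<in> int_vecs" "z \<noteq> 0" "z \<notin> columns K" for z
  proof -
    obtain x y where xy: "z = join x y" by (rule join_surj)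
    have x: "x \<in> int_vecs" and y: "y \<in> int_vecs"
      using z(1) by (simp_all add: xy join_int_vecs)
    have nx: "\<not> (x \<in> columns K1 \<and> y = 0)" and ny: "\<not> (x = 0 \<and> y \<in> columns K2)"
      using z(3) column_embed_matrices[of _ K1 K2] by (auto simp: xy columns_def K_def) metis+
    have n0: "\<not> (x = 0 \<and> y = 0)" using z(2) by (simp add: xy join_eq_0_iff)
    define s where "s = sphere_power T1 c1 x + sphere_power T2 c2 y"
    \<comment> \<open>If neither power reaches its gap, both \<open>x\<close> and \<open>y\<close>
      are vertices or 0, and \<open>nx\<close>, \<open>ny\<close>, \<open>n0\<close> exclude any
      zero.\<close>
    consider "x \<in> columns K1" "y \<in> columns K2" | "d \<le> s"
      using d1(2)[OF x] d2(2)[OF y] nx ny n0 delone_coords_nonneg[OF D1 x] delone_coords_nonneg[OF D2 y]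
      unfolding d_def s_def by linarith
    then show ?thesis
    proof cases
      case 1
      \<comment> \<open>At \<open>(v\<^sub>i, w\<^sub>j)\<close> both old powers and the square term
        vanish, which leaves \<open>2 * e\<close>.\<close>
      then show ?thesis
        unfolding xy Q using e by (auto simp: columns_def z1 z2 a b)
    next
      case 2
      define p where "p = b \<bullet> T2 y"
      have "0 \<le> (p - 1/2)\<^sup>2" by simp
      then have p: "- 1 \<le> p\<^sup>2 - p" by (simp add: power2_eq_square algebra_simps)
      have "- (C * (s + 1)) \<le> 2 * (a \<bullet> T1 x) * p"
        using C(2)[OF x y] by (simp add: s_def p_def abs_le_iff)
      then have 3: "- (e * (C * (s + 1))) \<le> 2 * e * (a \<bullet> T1 x) * p"
        using mult_left_mono[OF _ less_imp_le[OF e(1)]] by (fastforce simp: algebra_simps)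
      \<comment> \<open>Since \<open>e \<le> 1 \<le> s + 1\<close>, the error quadratic in
        \<open>e\<close> is absorbed into a bound linear in \<open>e\<close>.\<close>
      have "(e * A) * e \<le> (e * A) * (s + 1)"
        using e A 2 d by (intro mult_left_mono) auto
      then have "e\<^sup>2 * A \<le> e * A * (s + 1)"
        by (simp add: power2_eq_square algebra_simps)
      moreover have "e\<^sup>2 * A * (- 1) \<le> e\<^sup>2 * A * (p\<^sup>2 - p)"
        using A p by (intro mult_left_mono) auto
      ultimately have 4: "- (e * A * (s + 1)) \<le> e\<^sup>2 * A * (p\<^sup>2 - p)" by simp
      \<comment> \<open>The choice of \<open>e\<close> keeps the total loss from cross term and
        square term below \<open>s\<close>.\<close>
      have "e * (C * (s + 1)) + e * A * (s + 1) < s"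
        using e(3)[OF 2] by (simp add: algebra_simps)
      then show ?thesis
        using 3 4 unfolding xy Q p_def[symmetric] s_def[symmetric] by linarith
    qed
  qed
  ultimately have "delone_coords T c K"
    unfolding delone_coords_def by blast
  then show ?thesis unfolding K_def by blast
qed

end

theorem theorem1:
  assumes "CARD('c::finite) = CARD('a::finite) + CARD('b::finite)"
  shows "mv TYPE('c) \<ge> mv TYPE('a) * mv TYPE('b)"
proof -
  have "card (UNIV :: ('a + 'b) set) = card (UNIV :: 'c set)"
    using assms by (simp add: card_UNIV_sum)
  then obtain h where h: "bij_betw h (UNIV :: ('a + 'b) set) (UNIV :: 'c set)"
    using finite_same_card_bij[of "UNIV :: ('a + 'b) set" "UNIV :: 'c set"] by auto
  \<comment> \<open>Only the cardinality of \<open>'c\<close> is given, so a bijection from the sum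
    type provides the complementary index embeddings.\<close>
  define f g where "f = h \<circ> Inl" and "g = h \<circ> Inr"
  have inj: "inj f" "inj g"
    using h by (auto simp: f_def g_def bij_betw_def inj_def)
  have range: "range g = - range f"
    using h unfolding f_def g_def bij_betw_def inj_def
    by (auto simp: set_eq_iff image_iff) (metis sum.exhaust UNIV_I rangeE)+
  obtain T1 c1 and K1 :: "real^'a^'a" where K1: "delone_coords T1 c1 K1" "mv TYPE('a) = \<bar>det K1\<bar>"
    using mv_greatest(1)[where 'n = 'a] by (auto simp: delone_dets_def)
  obtain T2 c2 and K2 :: "real^'b^'b" where K2: "delone_coords T2 c2 K2" "mv TYPE('b) = \<bar>det K2\<bar>"
    using mv_greatest(1)[where 'n = 'b] by (auto simp: delone_dets_def)
  have "\<bar>det (embed_matrix f K1 ** embed_matrix g K2)\<bar> \<in> delone_dets TYPE('c)"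
    using delone_coords_product[OF inj range K1(1) K2(1)] unfolding delone_dets_def by blast
  then have "\<bar>det K1 * det K2\<bar> \<le> mv TYPE('c)"
    using mv_greatest(2) by (simp add: det_mul det_embed_matrix inj)
  then show ?thesis
    by (simp add: K1(2) K2(2) abs_mult)
qed

end
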